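(* Let $m\ge 2$ be an integer, let $\lambda=\frac32-\frac1{\sqrt3}$, and let $\delta>\frac{1-\lambda}{3-\lambda}$ be a real number. Let $D$ be the infinite matrix (depending on $m$ and $\delta$) defined in the context, whose first index is $*=(1,2^m)$, where $2^m$ denotes $m$ repetitions of the letter $2$. If $$\sum_{k=1}^\infty (D^k)_{*,*}\le 1,$$ then $\dim_H(\mathcal G)\le 1+\delta$, where $\mathcal G$ is the Rauzy gasket.
   Context: **Gasket.** Let $\Delta=\{(x_1,x_2,x_3)\in\mathbb R^3 : x_i\ge 0,\ x_1+x_2+x_3=1\}$ with the Euclidean metric. For $j\in\{1,2,3\}$ let $T_j:\Delta\to\Delta$ be the map whose $j$-th coordinate is $\frac{1}{2-x_j}$ and whose $i$-th coordinate is $\frac{x_i}{2-x_j}$ for $i\ne j$. The Rauzy gasket $\mathcal G$ is the smallest non-empty closed subset of $\Delta$ with $\mathcal G=\bigcup_{j=1}^3T_j(\mathcal G)$. For a word $\underline i=(i_1,\dots,i_n)\in\{1,2,3\}^n$ put $T_{\underline i}=T_{i_1}\circ\cdots\circ T_{i_n}$ and $\Delta_{\underline i}=T_{\underline i}(\Delta)$. **Index set.** In words, $a^k$ denotes the letter $a$ repeated $k$ times. For $1\le k\le m-1$ let $\mathcal V_k=\{(1^k,2,v_{k+2},\dots,v_{m+1}) : v_{k+2},\dots,v_{m+1}\in\{1,2,3\}\}\subset\{1,2,3\}^{m+1}$, and $\mathcal V=\bigcup_{k=1}^{m-1}\mathcal V_k$. Write $*=(1,2^m)\in\mathcal V_1$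 (a distinguished element). Two words $\underline i,\underline v\in\{1,2,3\}^{m+1}$ are equivalent, $\underline i\sim\underline v$, if there is a permutation $\pi$ of $\{1,2,3\}$ with $\pi(i_j)=v_j$ for all $j$. **Adjacency.** For $\underline v=(1^k,2,v_{k+2},\dots,v_{m+1})\in\mathcal V_k$ define relations $\underline v\mapsto_j\underline v'$ with $\underline v'\in\mathcal V\cup\{m\}$ ($m$ being regarded as an additional symbol) as follows. For $j=1$: if $k\le m-2$, then $\underline v\mapsto_1(1^{k+1},2,v_{k+2},\dots,v_m)$; if $k=m-1$, then $\underline v\mapsto_1 m$. For $j\in\{2,3\}$: $\underline v\mapsto_j\underline v'$, where $\underline v'\in\mathcal V_1$ is the element equivalent to $(j,1^k,2,v_{k+2},\dots,v_m)$. No relation starts from the symbol $m$. **Finite matrix.** $B$ is the square matrix indexed by $\mathcal V\cup\{m\}$ with $B_{\underline v,\underline w}=\max_{x\in\Delta_{\underline w}}(2-x_j)^{-3\delta-\lambda(1-\delta)}$ if $\underline w\mapsto_j\underline v$ for some $j$ (such a $j$ is unique), and $B_{\underline v,\underline w}=0$ otherwise. (So the row of $*$ and the column of $m$ vanish.) **Infinite matrix.** For $k\in\mathbb N$ let $$a_k=\Big(\tfrac{k+1}{2k+1}\Big)^{3\delta+\lambda(1-\delta)}+\tfrac1{8^\delta}\Big(\tfrac{k+1}{2k+1}\Big)^{\lambda(1-\delta)},\qquad b_k=\Big(\tfrac{k+2}{k+3}\Big)^{3\delta+\lambda(1-\delta)}.$$ $D$ is the infinite matrix indexed by $\mathcal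 V\cup\{m,m+1,m+2,\dots\}$ with entries: $D_{\alpha,\beta}=B_{\alpha,\beta}$ for $\alpha\in\mathcal V\cup\{m\}$ and $\beta\in\mathcal V$; $D_{*,k}=a_k$ for all $k\ge m$; $D_{k+1,k}=b_k$ for all $k\ge m$; and all other entries $0$. $D^k$ is the $k$-th matrix power, and $(D^k)_{*,*}$ its diagonal entry at the index $*$ (the index listed first). *)

theory Defs
  imports "HOL-Analysis.Analysis"
begin

text \<open>Coverings are by sequences of bounded sets, since \<^const>\<open>diameter\<close> is unspecified on
  unbounded sets. Finite coverings are included by padding with the empty set.\<close>

definition hausdorff_content :: "real \<Rightarrow> real \<Rightarrow> 'a::metric_space set \<Rightarrow> ennreal" where
  "hausdorff_content s \<epsilon> A =
     (INF U \<in> {U :: nat \<Rightarrow> 'a set. A \<subseteq> (\<Union>n. U n) \<and> (\<forall>n. bounded (U n) \<and> diameter (U n) \<le> \<epsilon>)}.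
        \<Sum>n. ennreal (diameter (U n) powr s))"

definition hausdorff_measure :: "real \<Rightarrow> 'a::metric_space set \<Rightarrow> ennreal" where
  "hausdorff_measure s A = (SUP \<epsilon> \<in> {0<..}. hausdorff_content s \<epsilon> A)"

text \<open>Only exponents \<open>s > 0\<close> are used, because \<open>0 powr 0 = 0\<close> in HOL would give a wrong
  zero-dimensional measure; leaving out \<open>s = 0\<close> does not change the infimum.\<close>

definition hausdorff_dim :: "'a::metric_space set \<Rightarrow> ennreal" where
  "hausdorff_dim A = (INF s \<in> {s. 0 < s \<and> hausdorff_measure s A = 0}. ennreal s)"

text \<open>The letters 1, 2, 3 are the elements of the three-element type \<^typ>\<open>3\<close> (in which
  \<open>3 = 0\<close>), which is also the index type of the coordinates of \<^typ>\<open>real^3\<close>.\<close>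

definition simplex3 :: "(real^3) set" where
  "simplex3 = {x. (\<forall>i. 0 \<le> x $ i) \<and> (\<Sum>i\<in>UNIV. x $ i) = 1}"

definition T :: "3 \<Rightarrow> real^3 \<Rightarrow> real^3" where
  "T j x = (\<chi> i. if i = j then 1 / (2 - x $ j) else x $ i / (2 - x $ j))"

definition rauzy_gasket :: "(real^3) set" where
  "rauzy_gasket =
     (LEAST G. G \<noteq> {} \<and> closed G \<and> G \<subseteq> simplex3 \<and> G = (\<Union>j\<in>UNIV. T j ` G))"

definition cylinder :: "3 list \<Rightarrow> (real^3) set" where
  "cylinder w = foldr T w ` simplex3"

definition words_k :: "nat \<Rightarrow> nat \<Rightarrow> 3 list set" where
  "words_k m k = {replicate k 1 @ 2 # u | u. length u = m - k}"

definition words :: "nat \<Rightarrow> 3 list set" where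
  "words m = (\<Union>k\<in>{1..m - 1}. words_k m k)"

definition star :: "nat \<Rightarrow> 3 list" where
  "star m = 1 # replicate m 2"

definition word_equiv :: "3 list \<Rightarrow> 3 list \<Rightarrow> bool" where
  "word_equiv v w \<longleftrightarrow> (\<exists>\<pi>. bij \<pi> \<and> map \<pi> v = w)"

datatype index = Word "3 list" | Num nat

definition indices :: "nat \<Rightarrow> index set" where
  "indices m = Word ` words m \<union> Num ` {m..}"

text \<open>\<open>adj m j (Word v) \<alpha>\<close> is the relation \<open>v \<mapsto>\<^sub>j \<alpha>\<close>. The tail \<open>u\<close> is
  \<open>(v\<^bsub>k+2\<^esub>, \<dots>, v\<^bsub>m+1\<^esub>)\<close>, so that \<^term>\<open>butlast u\<close> drops the letter \<open>v\<^bsub>m+1\<^esub>\<close>.\<close>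

inductive adj :: "nat \<Rightarrow> 3 \<Rightarrow> index \<Rightarrow> index \<Rightarrow> bool" for m :: nat where
  grow: "\<lbrakk>1 \<le> k; k + 2 \<le> m; length u = m - k\<rbrakk> \<Longrightarrow>
    adj m 1 (Word (replicate k 1 @ 2 # u)) (Word (replicate (k + 1) 1 @ 2 # butlast u))"
| exit: "\<lbrakk>1 \<le> k; k + 1 = m; length u = m - k\<rbrakk> \<Longrightarrow>
    adj m 1 (Word (replicate k 1 @ 2 # u)) (Num m)"
| restart: "\<lbrakk>j \<in> {2, 3}; 1 \<le> k; k + 1 \<le> m; length u = m - k;
     v' \<in> words_k m 1; word_equiv v' (j # replicate k 1 @ 2 # butlast u)\<rbrakk> \<Longrightarrow>
    adj m j (Word (replicate k 1 @ 2 # u)) (Word v')"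

text \<open>The supremum is a maximum, since cylinders are compact.\<close>

definition matB :: "nat \<Rightarrow> real \<Rightarrow> real \<Rightarrow> index \<Rightarrow> index \<Rightarrow> real" where
  "matB m lam \<delta> \<alpha> \<beta> =
     (case \<beta> of
        Word w \<Rightarrow>
          (if \<exists>j. adj m j (Word w) \<alpha>
           then (SUP x \<in> cylinder w.
                   (2 - x $ (THE j. adj m j (Word w) \<alpha>)) powr (- 3 * \<delta> - lam * (1 - \<delta>)))
           else 0)
      | Num _ \<Rightarrow> 0)"

definition a_coeff :: "real \<Rightarrow> real \<Rightarrow> nat \<Rightarrow> real" where
  "a_coeff lam \<delta> k =
     ((real k + 1) / (2 * real k + 1)) powr (3 * \<delta> + lam * (1 - \<delta>))
     + 1 / (8 powr \<delta>) * ((real k + 1) / (2 * real k + 1)) powr (lam * (1 - \<delta>))"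

definition b_coeff :: "real \<Rightarrow> real \<Rightarrow> nat \<Rightarrow> real" where
  "b_coeff lam \<delta> k = ((real k + 2) / (real k + 3)) powr (3 * \<delta> + lam * (1 - \<delta>))"

fun matD :: "nat \<Rightarrow> real \<Rightarrow> real \<Rightarrow> index \<Rightarrow> index \<Rightarrow> real" where
  "matD m lam \<delta> (Word v) (Word w) =
     (if v \<in> words m \<and> w \<in> words m then matB m lam \<delta> (Word v) (Word w) else 0)"
| "matD m lam \<delta> (Num l) (Word w) =
     (if l = m \<and> w \<in> words m then matB m lam \<delta> (Num m) (Word w) else 0)"
| "matD m lam \<delta> (Word v) (Num k) = (if v = star m \<and> m \<le> k then a_coeff lam \<delta> k else 0)"
| "matD m lam \<delta> (Num l) (Num k) = (if m \<le> k \<and> l = k + 1 then b_coeff lam \<delta> k else 0)"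

text \<open>Powers of a matrix indexed by a possibly infinite set \<open>I\<close>. Every column of \<^const>\<open>matD\<close>
  has only finitely many nonzero entries, so for this matrix all the sums have finite support.\<close>

primrec mat_pow :: "'i set \<Rightarrow> ('i \<Rightarrow> 'i \<Rightarrow> real) \<Rightarrow> nat \<Rightarrow> 'i \<Rightarrow> 'i \<Rightarrow> real" where
  "mat_pow I M 0 = (\<lambda>\<alpha> \<beta>. if \<alpha> = \<beta> then 1 else 0)"
| "mat_pow I M (Suc k) = (\<lambda>\<alpha> \<beta>. \<Sum>\<^sub>\<infinity>\<gamma>\<in>I. mat_pow I M k \<alpha> \<gamma> * M \<gamma> \<beta>)"

end

theory Submission
  imports Defs "HOL-Real_Asymp.Real_Asymp"
begin

text \<open>For a word \<open>i\<close>, the projective map \<open>T\<^sub>i\<close> has a linear denominator \<open>N\<^sub>i\<close> on the simplex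
  (\<open>wt i\<close> below). It contracts distances by \<open>N\<^sub>i\<^bsup>-\<lambda>\<^esup>\<close> and areas by \<open>N\<^sub>i\<^bsup>-3\<^esup>\<close>, and \<open>N\<^sub>i\<close> has bounded
  distortion on cylinders \<open>\<Delta>\<^bsub>ab\<^esub>\<close> with \<open>a \<noteq> b\<close>. Cutting the thin triangle \<open>\<Delta>\<^bsub>iab\<^esub>\<close> into pieces
  as wide as it is high shows that its \<open>(1+\<delta>)\<close>-dimensional content is at most a constant times
  \<open>N\<^sub>i\<^bsup>-s\<^esup>\<close> with \<open>s = 3\<delta> + \<lambda>(1-\<delta>)\<close>. Up to finitely many points the gasket is covered by the
  \<open>\<Delta>\<^bsub>iab\<^esub>\<close> with \<open>i\<close> of length at least \<open>N\<close>, so it suffices that \<open>\<Sum>\<^sub>i N\<^sub>i(z)\<^bsup>-s\<^esup> < \<infinity>\<close> for one point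
  \<open>z\<close>. The matrix \<open>D\<close> dominates the growth of this sum under prepending a letter; taking \<open>z\<close> in the
  cylinder of \<open>*\<close> and prepending the word \<open>*\<close> to all \<open>i\<close> bounds it by a multiple of
  \<open>\<Sum>\<^sub>k (D\<^sup>k)\<^bsub>*,*\<^esub>\<close>. This is for \<open>\<delta> \<le> 1\<close>; if \<open>\<delta> > 1\<close>, the bound exceeds the dimension of the
  simplex.\<close>

section \<open>Contraction of the maps\<close>

text \<open>All binomial coefficients of \<open>(1 - x) powr (- e)\<close> are positive, so its
  cubic Taylor polynomial lies below it. Here this follows because the polynomial times
  \<open>(1 - x) powr e\<close> is nonincreasing: in the derivative everything cancels except the
  top-order term \<open>- ((3 + e) * z * y^3)\<close>.\<close>

lemma one_minus_powr_lower:
  fixes e x :: real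
  assumes "0 < e" "0 \<le> x" "x < 1"
  defines "h \<equiv> e * (1 + e) / 2" and "z \<equiv> e * (1 + e) * (2 + e) / 6"
  shows "1 + e * x + h * x^2 + z * x^3 \<le> (1 - x) powr (- e)"
proof -
  define g where "g = (\<lambda>x. (1 + e * x + h * x^2 + z * x^3) * (1 - x) powr e)"
  have "g x \<le> g 0"
  proof (rule DERIV_nonpos_imp_nonincreasing[OF assms(2)], rule exI, rule conjI)
    fix y assume y: "0 \<le> y" "y \<le> x"
    then have y1: "0 < 1 - y" using assms by simp
    show "(g has_real_derivative
        ((e + 2 * h * y + 3 * z * y^2) * (1 - y) powr e
         - e * (1 + e * y + h * y^2 + z * y^3) * (1 - y) powr (e - 1))) (at y)"
      unfolding g_def using y1
      by (auto intro!: derivative_eq_intros simp: algebra_simps powr_diff power2_eq_square)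
    have "(1 - y) powr e = (1 - y) * (1 - y) powr (e - 1)"
      using y1 by (simp add: powr_diff)
    then have "((e + 2 * h * y + 3 * z * y^2) * (1 - y) powr e
         - e * (1 + e * y + h * y^2 + z * y^3) * (1 - y) powr (e - 1))
       = ((e + 2 * h * y + 3 * z * y^2) * (1 - y) - e * (1 + e * y + h * y^2 + z * y^3))
         * (1 - y) powr (e - 1)"
      by (simp only: left_diff_distrib mult.assoc)
    also have "(e + 2 * h * y + 3 * z * y^2) * (1 - y) - e * (1 + e * y + h * y^2 + z * y^3)
       = - ((3 + e) * z * y^3)"
      unfolding h_def z_def by (simp add: field_simps power2_eq_square power3_eq_cube)
    also have "\<dots> * (1 - y) powr (e - 1) \<le> 0"
      using y assms by (auto simp: z_def intro!: mult_nonneg_nonneg)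
    finally show "((e + 2 * h * y + 3 * z * y^2) * (1 - y) powr e
         - e * (1 + e * y + h * y^2 + z * y^3) * (1 - y) powr (e - 1)) \<le> 0" .
  qed
  then have "(1 + e * x + h * x^2 + z * x^3) * (1 - x) powr e \<le> 1" by (simp add: g_def)
  then show ?thesis using assms by (simp add: powr_minus field_simps)
qed

text \<open>To third order \<open>u\<close> is \<open>e x + h x\<^sup>2 + z x\<^sup>3\<close>. Since \<open>(1 + e)\<^sup>2 = 4 / 3\<close>, inserting this into
  \<open>3 u\<^sup>2 + 6 u x - 4 u x\<^sup>2 - x\<^sup>2\<close> makes the terms of orders \<open>x\<^sup>2\<close> and \<open>x\<^sup>3\<close> vanish.\<close>

lemma contraction_discriminant:
  fixes e x u :: real
  assumes e: "e = 2 / sqrt 3 - 1" and x: "0 \<le> x" "x \<le> 1 / 2" and u: "u = (1 - x) powr (- e) - 1"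
  shows "0 \<le> u" and "x = 0 \<or> 0 < u" and "(u - x)^2 \<le> 4 * u * (u + x - x^2)"
proof -
  define h where "h = e * (1 + e) / 2"
  define z where "z = e * (1 + e) * (2 + e) / 6"
  have e0: "0 < e"
  proof -
    have "sqrt 3 < sqrt 4" by (subst real_sqrt_less_iff) simp
    then show ?thesis unfolding e by (simp add: field_simps)
  qed
  have e2: "e^2 = 1 / 3 - 2 * e"
    unfolding e by (simp add: power2_eq_square field_simps)
  define p where "p = e * x + h * x^2 + z * x^3"
  have hz: "0 < h" "0 < z" using e0 by (auto simp: h_def z_def)
  have p0: "0 \<le> p" using hz e0 x by (simp add: p_def)
  have px: "x = 0 \<or> 0 < p" 
    using hz e0 x by (cases "x = 0") (auto simp: p_def intro!: add_pos_nonneg)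
  have up: "p \<le> u" using one_minus_powr_lower[of e x] e0 x by (simp add: u p_def h_def z_def)
  show "0 \<le> u" "x = 0 \<or> 0 < u" using p0 px up by auto
  have h': "h = 1 / 6 - e / 2" unfolding h_def using e2 by (simp add: power2_eq_square field_simps)
  have z': "z = 1 / 18 + e / 18"
  proof -
    have "z = (2 * e + 3 * e^2 + e * e^2) / 6" by (simp add: z_def power2_eq_square field_simps)
    also have "e * e^2 = e * (1/3 - 2 * e)" by (simp only: e2)
    also have "\<dots> = e / 3 - 2 * e^2" by (simp add: power2_eq_square field_simps)
    finally show ?thesis using e2 by (simp add: field_simps)
  qed
  have ee: "e * e = 1 / 3 - 2 * e" using e2 by (simp add: power2_eq_square)
  have "3 * p^2 + 6 * p * x - 4 * p * x^2 - x^2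
    = x^2 * (3 * (e + h * x + z * x^2)^2 + (6 - 4 * x) * (e + h * x + z * x^2) - 1)"
    unfolding p_def by (simp add: power2_eq_square power3_eq_cube algebra_simps)
  also have "3 * (e + h * x + z * x^2)^2 + (6 - 4 * x) * (e + h * x + z * x^2) - 1
    = (3 * (e*e) + 6 * e - 1) + (6 * (e * h) + 6 * h - 4 * e) * x
      + (3 * (h * h) + 6 * (e * z) + 6 * z - 4 * h) * x^2 + (6 * (h * z) - 4 * z) * x^3 + 3 * z^2 * x^4"
    by (simp add: power2_eq_square power3_eq_cube power4_eq_xxxx algebra_simps)
  also have "3 * (e*e) + 6 * e - 1 = 0" using ee by simp
  also have "6 * (e * h) + 6 * h - 4 * e = 0" unfolding h' using ee by (simp add: algebra_simps)
  also have "3 * (h * h) + 6 * (e * z) + 6 * z - 4 * h = 1 / 9"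
    unfolding h' z' using ee by (simp add: algebra_simps)
  also have "6 * (h * z) - 4 * z = - 2 / 9"
    unfolding h' z' using ee by (simp add: algebra_simps)
  \<comment> \<open>The remainder of order four is nonnegative because \<open>x \<le> 1 / 2\<close>;
    this range corresponds to denominators \<open>t \<le> 2\<close>.\<close>
  also have "x^2 * (0 + 0 * x + 1 / 9 * x^2 + - 2 / 9 * x^3 + 3 * z^2 * x^4)
     = x^4 * ((1 - 2 * x) / 9 + 3 * z^2 * x^2)"
    by (simp add: power2_eq_square power3_eq_cube power4_eq_xxxx field_simps)
  finally have "0 \<le> 3 * p^2 + 6 * p * x - 4 * p * x^2 - x^2" using x by simp
  \<comment> \<open>The expression is increasing in \<open>p \<ge> 0\<close>, so the Taylor
    polynomial \<open>p\<close> may be replaced by the larger \<open>u\<close>.\<close>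
  moreover have "3 * p^2 + 6 * p * x - 4 * p * x^2 \<le> 3 * u^2 + 6 * u * x - 4 * u * x^2"
  proof -
    have "p * (x * (6 - 4 * x)) \<le> u * (x * (6 - 4 * x))"
      using up x by (intro mult_right_mono) auto
    moreover have "p^2 \<le> u^2" using up p0 by (intro power_mono)
    ultimately show ?thesis by (simp add: power2_eq_square algebra_simps)
  qed
  ultimately show "(u - x)^2 \<le> 4 * u * (u + x - x^2)" by (simp add: power2_eq_square algebra_simps)
qed

text \<open>Here \<open>(a, b, c)\<close> is the difference of two points of the simplex and
  \<open>t\<close> the denominator at the second one. For fixed \<open>t\<close> the left side is
  convex in the way \<open>q2 + q3\<close> is distributed, so it is largest when one coordinate
  carries everything. There the claim is the semidefiniteness of a binary quadratic form, that is, a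
  discriminant condition.\<close>

lemma contraction_quadratic_form:
  fixes e t q2 q3 a b c :: real
  assumes e: "e = 2 / sqrt 3 - 1" and q: "0 \<le> q2" "0 \<le> q3" "t = 1 + q2 + q3" "t \<le> 2"
    and abc: "a + b + c = 0"
  shows "(a / t)^2 + (b + a * q2 / t)^2 + (c + a * q3 / t)^2 \<le> (a^2 + b^2 + c^2) * t powr e"
proof -
  have t: "1 \<le> t" "0 < t" using q by auto
  define x where "x = (q2 + q3) / t"
  have x: "0 \<le> x" "x \<le> 1 / 2" using q t by (auto simp: x_def field_simps)
  have tx: "1 / t = 1 - x" using q t by (simp add: x_def field_simps)
  define u where "u = (1 - x) powr (- e) - 1"
  have tu: "t powr e = 1 + u"
    unfolding u_def tx[symmetric] using t by (simp add: powr_minus powr_divide)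
  note disc = contraction_discriminant[OF e x u_def]
  \<comment> \<open>The endpoint case. Eliminating \<open>c\<close> leaves the form \<open>Q\<close>
    in \<open>a\<close> and \<open>b\<close>; completing the square in \<open>b\<close> exposes the
    discriminant.\<close>
  have extreme: "((1 - x) * a)^2 + (b + a * x)^2 + c^2 \<le> (a^2 + b^2 + c^2) * (1 + u)"
    if "a + b + c = 0" for b c
  proof -
    define Q where "Q = a^2 * (u + x - x^2) + a * b * (u - x) + u * b^2"
    have c: "c = - a - b" using that by simp
    have Q: "(a^2 + b^2 + c^2) * (1 + u) - (((1 - x) * a)^2 + (b + a * x)^2 + c^2) = 2 * Q"
      unfolding c Q_def by (simp add: power2_eq_square algebra_simps)
    have "0 \<le> Q"
    proof (cases "0 < u")
      case True
      have "4 * u * Q = (2 * u * b + a * (u - x))^2 + a^2 * (4 * u * (u + x - x^2) - (u - x)^2)"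
        unfolding Q_def by (simp add: power2_eq_square algebra_simps)
      also have "\<dots> \<ge> 0" using disc(3) by simp
      finally show ?thesis using True by (simp add: zero_le_mult_iff)
    next
      case False
      then have "x = 0" "u = 0" using disc by auto
      then show ?thesis by (simp add: Q_def)
    qed
    then show ?thesis using Q by linarith
  qed
  define m where "m = q2 / t"
  define n where "n = q3 / t"
  have mn: "0 \<le> m" "0 \<le> n" "m + n = x"
    using q t by (auto simp: m_def n_def x_def add_divide_distrib)
  show ?thesis
  proof (cases "x = 0")
    case True
    then have "q2 = 0" "q3 = 0" using q t by (auto simp: x_def)
    then show ?thesis using q by simp
  next
    case False
    let ?L = "((1 - x) * a)^2 + (b + a * m)^2 + (c + a * n)^2"
    \<comment> \<open>Convexity in explicit form: the weighted endpoint values minus a nonnegative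
      defect.\<close>
    have "(m + n) * ?L = m * (((1 - x) * a)^2 + (b + a * x)^2 + c^2)
          + n * (((1 - x) * a)^2 + (c + a * x)^2 + b^2) - 2 * m * n * a^2 * x"
      unfolding mn(3)[symmetric] by (simp add: power2_eq_square algebra_simps)
    also have "\<dots> \<le> m * ((a^2 + b^2 + c^2) * (1 + u)) + n * ((a^2 + c^2 + b^2) * (1 + u)) - 0"
      using mn x extreme[of b c] extreme[of c b] abc
      by (intro diff_mono add_mono mult_left_mono) (auto simp: algebra_simps)
    also have "\<dots> = (m + n) * ((a^2 + b^2 + c^2) * (1 + u))" by (simp add: algebra_simps)
    finally have "?L \<le> (a^2 + b^2 + c^2) * (1 + u)" using False x mn by (simp add: mult_le_cancel_left)
    moreover have "a / t = (1 - x) * a" by (simp add: tx[symmetric])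
    ultimately show ?thesis by (simp add: tu m_def n_def)
  qed
qed

section \<open>From the quadratic form to distances in the simplex\<close>

lemma simplex3_iff: "x \<in> simplex3 \<longleftrightarrow> 0 \<le> x $ 1 \<and> 0 \<le> x $ 2 \<and> 0 \<le> x $ 3 \<and> x $ 1 + x $ 2 + x $ 3 = 1"
  by (auto simp: simplex3_def sum_3 forall_3)

lemma simplex3_nth_bounds:
  assumes "x \<in> simplex3" shows "0 \<le> x $ j" "x $ j \<le> 1"
  using assms exhaust_3[of j] by (auto simp: simplex3_iff)

lemma T_nth: "T j x $ i = (if i = j then 1 else x $ i) / (2 - x $ j)"
  by (simp add: T_def)

lemma T_in_simplex3:
  assumes "x \<in> simplex3" shows "T j x \<in> simplex3"
proof -
  have "x $ j \<le> 1" using simplex3_nth_bounds[OF assms] by auto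
  then show ?thesis using assms exhaust_3[of j]
    by (auto simp: simplex3_iff T_nth divide_simps)
qed

lemma norm_real3_sq: "(norm (v :: real^3))\<^sup>2 = (v $ 1)\<^sup>2 + (v $ 2)\<^sup>2 + (v $ 3)\<^sup>2"
  by (simp add: norm_vec_def L2_set_def sum_3)

text \<open>The formula is deliberately asymmetric: the denominator of \<open>p\<close> is a common
  factor, and what remains is linear in \<open>p - q\<close> with coefficients depending on
  \<open>q\<close> only, as in \<open>contraction_quadratic_form\<close>.\<close>

lemma T_diff_nth:
  assumes "p \<in> simplex3" "q \<in> simplex3"
  shows "(T j p - T j q) $ i = (if i = j then (p - q) $ j / (2 - q $ j)
           else (p - q) $ i + (p - q) $ j * q $ i / (2 - q $ j)) / (2 - p $ j)"
proof -
  have "p $ j \<le> 1" "q $ j \<le> 1" using assms simplex3_nth_bounds by auto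
  then have "2 - p $ j \<noteq> 0" "2 - q $ j \<noteq> 0" by auto
  then show ?thesis by (auto simp: T_nth divide_simps) (auto simp: algebra_simps)
qed

lemma powr_sq: "(a powr b)\<^sup>2 = a powr (2 * b)" for a b :: real
  by (simp add: power2_eq_square powr_add[symmetric])

lemma dist_T_le_aux:
  assumes p: "p \<in> simplex3" and q: "q \<in> simplex3" and lam: "lam = 3 / 2 - 1 / sqrt 3"
  shows "dist (T j p) (T j q) \<le> dist p q * (2 - q $ j) powr (1 - lam) / (2 - p $ j)"
proof -
  define v where "v = p - q"
  have v0: "v $ 1 + v $ 2 + v $ 3 = 0" using p q by (simp add: simplex3_iff v_def)
  \<comment> \<open>The quadratic form concerns squared lengths, so its exponent is twice
    \<open>1 - lam\<close>.\<close>
  have e: "2 * (1 - lam) = 2 / sqrt 3 - 1" unfolding lam by simp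
  have pj: "0 < 2 - p $ j" using simplex3_nth_bounds(2)[OF p, of j] by simp
  have qj: "0 < 2 - q $ j" using simplex3_nth_bounds(2)[OF q, of j] by simp
  have "(norm (T j p - T j q))\<^sup>2 * (2 - p $ j)\<^sup>2
      \<le> (norm v)\<^sup>2 * (2 - q $ j) powr (2 * (1 - lam))"
    using q v0 pj contraction_quadratic_form[OF e, of "q $ 2" "q $ 3" "2 - q $ 1" "v $ 1" "v $ 2" "v $ 3"]
     contraction_quadratic_form[OF e, of "q $ 1" "q $ 3" "2 - q $ 2" "v $ 2" "v $ 1" "v $ 3"]
     contraction_quadratic_form[OF e, of "q $ 1" "q $ 2" "2 - q $ 3" "v $ 3" "v $ 1" "v $ 2"]
     exhaust_3[of j]
    unfolding norm_real3_sq
    by (auto simp: T_diff_nth[OF p q] v_def[symmetric] simplex3_iff power_divide add_divide_distrib[symmetric]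
          simp del: vector_minus_component) (auto simp: algebra_simps)
  then have "(norm (T j p - T j q) * (2 - p $ j))\<^sup>2 \<le> (norm v * (2 - q $ j) powr (1 - lam))\<^sup>2"
    by (simp add: power_mult_distrib powr_sq)
  then have "norm (T j p - T j q) * (2 - p $ j) \<le> norm v * (2 - q $ j) powr (1 - lam)"
    by (rule power2_le_imp_le) simp
  then show ?thesis using pj by (simp add: dist_norm v_def field_simps)
qed

lemma contraction_exponent_bounds:
  assumes "lam = 3 / 2 - 1 / sqrt 3" shows "0 < lam" "lam < 1"
proof -
  have "sqrt 3 < sqrt 4" unfolding real_sqrt_less_iff by simp
  then have "1 / sqrt 3 > 1 / 2" by (simp add: field_simps)
  moreover have "1 / sqrt 3 < 1" by simp
  ultimately show "0 < lam" "lam < 1" unfolding assms by linarith+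
qed

text \<open>The asymmetric estimate is applied in whichever order of \<open>p\<close> and
  \<open>q\<close> allows the denominator at \<open>q\<close> to be replaced by the one at
  \<open>p\<close>; this uses \<open>0 < 1 - lam\<close>.\<close>

lemma dist_T_le:
  assumes p: "p \<in> simplex3" and q: "q \<in> simplex3" and lam: "lam = 3 / 2 - 1 / sqrt 3"
  shows "dist (T j p) (T j q) \<le> dist p q * (2 - p $ j) powr (- lam)"
proof -
  have pj: "1 \<le> 2 - p $ j" using simplex3_nth_bounds(2)[OF p, of j] by simp
  have qj: "1 \<le> 2 - q $ j" using simplex3_nth_bounds(2)[OF q, of j] by simp
  note l = contraction_exponent_bounds[OF lam]
  show ?thesis
  proof (cases "q $ j \<ge> p $ j")
    case True
    have "dist (T j p) (T j q) \<le> dist p q * (2 - q $ j) powr (1 - lam) / (2 - p $ j)"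
      by (rule dist_T_le_aux[OF assms])
    also have "\<dots> \<le> dist p q * (2 - p $ j) powr (1 - lam) / (2 - p $ j)"
      using True pj qj l by (intro divide_right_mono mult_left_mono powr_mono2) auto
    also have "\<dots> = dist p q * (2 - p $ j) powr (- lam)"
      using pj by (simp add: powr_diff powr_minus field_simps)
    finally show ?thesis .
  next
    case False
    have "dist (T j q) (T j p) \<le> dist q p * (2 - p $ j) powr (1 - lam) / (2 - q $ j)"
      by (rule dist_T_le_aux[OF q p lam])
    also have "\<dots> \<le> dist q p * (2 - p $ j) powr (1 - lam) / (2 - p $ j)"
      using False pj qj l by (intro divide_left_mono) auto
    also have "\<dots> = dist p q * (2 - p $ j) powr (- lam)"
      using pj by (simp add: powr_diff powr_minus field_simps dist_commute)
    finally show ?thesis by (simp add: dist_commute)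
  qed
qed

section \<open>Words, areas and distortion\<close>

text \<open>The denominator as a cocycle: one-letter denominators are multiplied along the orbit of
  \<open>x\<close>, the last letter of the word acting first.\<close>

fun wt :: "3 list \<Rightarrow> real^3 \<Rightarrow> real" where
  "wt [] x = 1"
| "wt (j # i) x = wt i x * (2 - foldr T i x $ j)"

lemma foldr_T_in_simplex3: "x \<in> simplex3 \<Longrightarrow> foldr T i x \<in> simplex3"
  by (induction i) (auto intro: T_in_simplex3)

lemma wt_append: "wt (i @ w) x = wt w x * wt i (foldr T w x)"
  by (induction i) auto

lemma wt_bounds:
  assumes "x \<in> simplex3" shows "1 \<le> wt i x" "wt i x \<le> 2 ^ length i"
proof (induction i)
  case (Cons j i)
  have *: "1 \<le> 2 - foldr T i x $ j" "2 - foldr T i x $ j \<le> 2"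
    using simplex3_nth_bounds[OF foldr_T_in_simplex3[OF assms], of i j] by auto
  {
    case 1 show ?case using Cons(1) * mult_mono[of 1 "wt i x" 1 "2 - foldr T i x $ j"] by simp
  next
    case 2 show ?case using Cons * mult_mono[of "wt i x" "2 ^ length i" "2 - foldr T i x $ j" 2] by simp
  }
qed auto

lemma wt_pos: "x \<in> simplex3 \<Longrightarrow> 0 < wt i x"
  using wt_bounds(1)[of x i] by simp

lemma dist_foldr_T_le:
  assumes lam: "lam = 3 / 2 - 1 / sqrt 3" and p: "p \<in> simplex3" and q: "q \<in> simplex3"
  shows "dist (foldr T i p) (foldr T i q) \<le> dist p q * wt i p powr (- lam)"
proof (induction i)
  case (Cons j i)
  have "dist (foldr T (j # i) p) (foldr T (j # i) q)
     \<le> dist (foldr T i p) (foldr T i q) * (2 - foldr T i p $ j) powr (- lam)"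
    using dist_T_le[OF foldr_T_in_simplex3[OF p, of i] foldr_T_in_simplex3[OF q, of i] lam, of j] by simp
  also have "\<dots> \<le> (dist p q * wt i p powr (- lam)) * (2 - foldr T i p $ j) powr (- lam)"
    by (intro mult_right_mono Cons) simp
  also have "\<dots> = dist p q * wt (j # i) p powr (- lam)"
    using wt_pos[OF p, of i] simplex3_nth_bounds(2)[OF foldr_T_in_simplex3[OF p, of i], of j]
    by (simp add: powr_mult)
  finally show ?case .
qed simp

section \<open>Areas of triangles in the simplex, measured by a determinant\<close>

definition det3 :: "real^3 \<Rightarrow> real^3 \<Rightarrow> real^3 \<Rightarrow> real" where
  "det3 p q r = p $ 1 * (q $ 2 * r $ 3 - q $ 3 * r $ 2) - p $ 2 * (q $ 1 * r $ 3 - q $ 3 * r $ 1)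
     + p $ 3 * (q $ 1 * r $ 2 - q $ 2 * r $ 1)"

text \<open>Multiplied by its denominator, \<open>T j\<close> replaces coordinate \<open>j\<close>
  by 1, which on the simplex is the sum of all coordinates. This is a column operation and leaves
  the determinant unchanged.\<close>

lemma det3_T:
  assumes "p \<in> simplex3" "q \<in> simplex3" "r \<in> simplex3"
  shows "det3 (T j p) (T j q) (T j r) * ((2 - p $ j) * (2 - q $ j) * (2 - r $ j)) = det3 p q r"
proof -
  have "p $ j \<le> 1" "q $ j \<le> 1" "r $ j \<le> 1" using assms simplex3_nth_bounds by auto
  then have nz: "2 - p $ j \<noteq> 0" "2 - q $ j \<noteq> 0" "2 - r $ j \<noteq> 0" by auto
  have *: "det3 (T j p) (T j q) (T j r) * ((2 - p $ j) * (2 - q $ j) * (2 - r $ j))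
     = det3 ((2 - p $ j) *\<^sub>R T j p) ((2 - q $ j) *\<^sub>R T j q) ((2 - r $ j) *\<^sub>R T j r)"
    by (simp add: det3_def algebra_simps)
  have s: "(2 - x $ j) *\<^sub>R T j x = (\<chi> i. if i = j then 1 else x $ i)" if "x $ j \<le> 1" for x
    using that by (auto simp: vec_eq_iff T_nth)
  have e: "p $ 3 = 1 - p $ 1 - p $ 2" "q $ 3 = 1 - q $ 1 - q $ 2" "r $ 3 = 1 - r $ 1 - r $ 2"
    using assms by (auto simp: simplex3_iff)
  show ?thesis unfolding * s[OF \<open>p $ j \<le> 1\<close>] s[OF \<open>q $ j \<le> 1\<close>] s[OF \<open>r $ j \<le> 1\<close>]
    using exhaust_3[of j] by (auto simp: det3_def e) (auto simp: algebra_simps)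
qed

lemma det3_foldr_T:
  assumes "p \<in> simplex3" "q \<in> simplex3" "r \<in> simplex3"
  shows "det3 (foldr T i p) (foldr T i q) (foldr T i r) * (wt i p * wt i q * wt i r) = det3 p q r"
proof (induction i)
  case (Cons j i)
  have "det3 (foldr T (j # i) p) (foldr T (j # i) q) (foldr T (j # i) r)
      * (wt (j # i) p * wt (j # i) q * wt (j # i) r)
    = (det3 (T j (foldr T i p)) (T j (foldr T i q)) (T j (foldr T i r))
      * ((2 - foldr T i p $ j) * (2 - foldr T i q $ j) * (2 - foldr T i r $ j)))
      * (wt i p * wt i q * wt i r)"
    by (simp add: mult_ac)
  also have "\<dots> = det3 p q r"
    by (subst det3_T) (use assms Cons in \<open>auto intro: foldr_T_in_simplex3\<close>)
  finally show ?case .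
qed simp

text \<open>Both edge vectors have coordinate sum 0, so their cross product is a multiple of
  \<open>(1, 1, 1)\<close>, with factor \<open>det3 p q r\<close>. Its norm is twice the area of the
  triangle.\<close>

lemma norm_cross_simplex3:
  assumes "p \<in> simplex3" "q \<in> simplex3" "r \<in> simplex3"
  shows "norm (cross3 (q - p) (r - p)) = sqrt 3 * \<bar>det3 p q r\<bar>"
proof -
  have e: "p $ 3 = 1 - p $ 1 - p $ 2" "q $ 3 = 1 - q $ 1 - q $ 2" "r $ 3 = 1 - r $ 1 - r $ 2"
    using assms by (auto simp: simplex3_iff)
  have "cross3 (q - p) (r - p) $ k = det3 p q r" for k
    using exhaust_3[of k] by (auto simp: cross3_def det3_def e) (auto simp: algebra_simps)
  then have "(norm (cross3 (q - p) (r - p)))\<^sup>2 = (sqrt 3 * \<bar>det3 p q r\<bar>)\<^sup>2"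
    by (simp add: norm_real3_sq power_mult_distrib)
  then show ?thesis by (simp add: power2_eq_iff_nonneg)
qed

lemma det3_simplex3_le:
  assumes "p \<in> simplex3" "q \<in> simplex3" "r \<in> simplex3"
  shows "\<bar>det3 p q r\<bar> \<le> 1"
proof -
  have b: "\<bar>a * d - b * c\<bar> \<le> 1" if "0 \<le> a" "a \<le> 1" "0 \<le> b" "b \<le> 1" "0 \<le> c" "c \<le> 1" "0 \<le> d" "d \<le> 1"
    for a b c d :: real
  proof -
    have "0 \<le> a * d" "a * d \<le> 1" "0 \<le> b * c" "b * c \<le> 1" using that by (auto intro: mult_le_one)
    then show ?thesis by linarith
  qed
  note bd = simplex3_nth_bounds
  let ?A = "q $ 2 * r $ 3 - q $ 3 * r $ 2" and ?B = "q $ 1 * r $ 3 - q $ 3 * r $ 1"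
    and ?C = "q $ 1 * r $ 2 - q $ 2 * r $ 1"
  have "\<bar>?A\<bar> \<le> 1" "\<bar>?B\<bar> \<le> 1" "\<bar>?C\<bar> \<le> 1" using assms bd by (auto intro!: b)
  then have "\<bar>p $ 1 * ?A\<bar> \<le> p $ 1 * 1" "\<bar>p $ 2 * ?B\<bar> \<le> p $ 2 * 1" "\<bar>p $ 3 * ?C\<bar> \<le> p $ 3 * 1"
    unfolding abs_mult using bd[OF assms(1)] by (auto intro!: mult_left_mono simp: mult_left_le)
  then show ?thesis using assms(1) unfolding det3_def simplex3_iff by linarith
qed

text \<open>The coefficients are the column sums of a product of the integer matrices inducing the
  \<^const>\<open>T\<close>; the triangle inequality among them survives a further factor.\<close>

lemma wt_linear:
  "\<exists>c :: 3 \<Rightarrow> real. (\<forall>x\<in>simplex3. wt i x = (\<Sum>k\<in>UNIV. c k * x $ k)) \<and> (\<forall>k. 0 < c k) \<and>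
     c 1 \<le> c 2 + c 3 \<and> c 2 \<le> c 1 + c 3 \<and> c 3 \<le> c 1 + c 2"
proof (induction i rule: rev_induct)
  case Nil
  show ?case by (rule exI[of _ "\<lambda>_. 1"]) (auto simp: simplex3_def)
next
  case (snoc j i)
  then obtain c where c: "\<And>x. x \<in> simplex3 \<Longrightarrow> wt i x = (\<Sum>k\<in>UNIV. c k * x $ k)" "\<And>k. 0 < c k"
    "c 1 \<le> c 2 + c 3" "c 2 \<le> c 1 + c 3" "c 3 \<le> c 1 + c 2" by blast
  \<comment> \<open>An inner letter \<open>j\<close> turns coordinate \<open>j\<close> into 1, the
    sum of all coordinates, so \<open>c j\<close> is added to the other two coefficients.\<close>
  define d where "d = (\<lambda>k. if k = j then c j else c k + c j)"
  have "wt (i @ [j]) x = (\<Sum>k\<in>UNIV. d k * x $ k)" if x: "x \<in> simplex3" for x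
  proof -
    have xj: "2 - x $ j \<noteq> 0" using simplex3_nth_bounds(2)[OF x, of j] by simp
    have e: "x $ 3 = 1 - x $ 1 - x $ 2" using x by (auto simp: simplex3_iff)
    have "wt (i @ [j]) x = (2 - x $ j) * (\<Sum>k\<in>UNIV. c k * T j x $ k)"
      using x by (simp add: wt_append c(1) T_in_simplex3)
    also have "\<dots> = (\<Sum>k\<in>UNIV. c k * (if k = j then 1 else x $ k))"
      using xj by (simp add: T_nth sum_distrib_left)
    also have "\<dots> = (\<Sum>k\<in>UNIV. d k * x $ k)"
      using exhaust_3[of j] by (auto simp: d_def sum_3 e) (auto simp: algebra_simps)
    finally show ?thesis .
  qed
  moreover have "\<forall>k. 0 < d k" using c(2) by (auto simp: d_def intro: add_pos_pos)
  moreover have "d 1 \<le> d 2 + d 3 \<and> d 2 \<le> d 1 + d 3 \<and> d 3 \<le> d 1 + d 2"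
    using exhaust_3[of j] c(2)[of 1] c(2)[of 2] c(2)[of 3] c(3-5) by (auto simp: d_def)
  ultimately show ?case by blast
qed

lemma cylinder_Cons: "cylinder (j # w) = T j ` cylinder w"
  by (auto simp: cylinder_def)

lemma cylinder_append: "cylinder (i @ w) = foldr T i ` cylinder w"
  by (auto simp: cylinder_def)

lemma cylinder_subset_simplex3: "cylinder w \<subseteq> simplex3"
  by (auto simp: cylinder_def intro: foldr_T_in_simplex3)

lemma cylinder_append_subset: "cylinder (i @ w) \<subseteq> cylinder i"
  unfolding cylinder_append using cylinder_subset_simplex3[of w] by (auto simp: cylinder_def)

lemma T_nth_ge_half: "x \<in> simplex3 \<Longrightarrow> 1 / 2 \<le> T j x $ j"
  using simplex3_nth_bounds[of x j] by (simp add: T_nth field_simps)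

text \<open>On the cylinder both \<open>x $ a\<close> and \<open>x $ b\<close> are at least
  \<open>1 / 4\<close>, so \<open>wt i x\<close> is at least a quarter of \<open>c a + c b\<close>.
  By the triangle inequality no coefficient exceeds \<open>c a + c b\<close>, which therefore bounds
  \<open>wt i\<close> on the whole simplex.\<close>

lemma wt_distortion:
  assumes x: "x \<in> cylinder [a, b]" and ab: "a \<noteq> b" and z: "z \<in> simplex3"
  shows "wt i z / 4 \<le> wt i x"
proof -
  obtain c where c: "\<And>x. x \<in> simplex3 \<Longrightarrow> wt i x = (\<Sum>k\<in>UNIV. c k * x $ k)" "\<And>k. 0 < c k"
    "c 1 \<le> c 2 + c 3" "c 2 \<le> c 1 + c 3" "c 3 \<le> c 1 + c 2" using wt_linear[of i] by blast
  have xs: "x \<in> simplex3" using x cylinder_subset_simplex3 by blast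
  obtain y where y: "y \<in> simplex3" "x = T a (T b y)" using x by (auto simp: cylinder_def)
  have xa: "1 / 4 \<le> x $ a" using T_nth_ge_half[OF T_in_simplex3[OF y(1)], of a b] y by simp
  have xb: "1 / 4 \<le> x $ b"
    using ab y simplex3_nth_bounds[OF T_in_simplex3[OF y(1)], of b a] T_nth_ge_half[OF y(1), of b]
    by (simp add: T_nth[of a] field_simps)
  have "c a + c b \<le> 4 * (c a * x $ a + c b * x $ b)"
    using mult_left_mono[OF xa less_imp_le[OF c(2)[of a]]] mult_left_mono[OF xb less_imp_le[OF c(2)[of b]]]
    unfolding distrib_left by linarith
  also have "c a * x $ a + c b * x $ b \<le> (\<Sum>k\<in>UNIV. c k * x $ k)"
    using sum_mono2[of UNIV "{a, b}" "\<lambda>k. c k * x $ k"] ab c(2) simplex3_nth_bounds(1)[OF xs]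
    by (simp add: less_imp_le)
  finally have 1: "c a + c b \<le> 4 * wt i x" by (simp add: c(1)[OF xs])
  have m: "c k \<le> c a + c b" for k
    using ab exhaust_3[of a] exhaust_3[of b] exhaust_3[of k] c(2)[of 1] c(2)[of 2] c(2)[of 3] c(3-5) by auto
  have "wt i z \<le> (\<Sum>k\<in>UNIV. (c a + c b) * z $ k)"
    unfolding c(1)[OF z] using simplex3_nth_bounds(1)[OF z] m
    by (intro sum_mono mult_right_mono) auto
  also have "\<dots> = c a + c b" using z by (simp add: sum_distrib_left[symmetric] simplex3_def)
  finally show ?thesis using 1 by simp
qed

text \<open>A projective map preserves convex combinations up to reweighting: each barycentric
  weight is multiplied by the denominator at its vertex and then normalised.\<close>

lemma T_image_convex_hull:
  assumes "p \<in> simplex3" "q \<in> simplex3" "r \<in> simplex3"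
  shows "T j ` (convex hull {p, q, r}) \<subseteq> convex hull {T j p, T j q, T j r}"
proof
  fix y assume "y \<in> T j ` (convex hull {p, q, r})"
  then obtain u v w where uvw: "0 \<le> u" "0 \<le> v" "0 \<le> w" "u + v + w = 1"
    and y: "y = T j (u *\<^sub>R p + v *\<^sub>R q + w *\<^sub>R r)" by (auto simp: convex_hull_3)
  let ?x = "u *\<^sub>R p + v *\<^sub>R q + w *\<^sub>R r"
  have P: "0 < 2 - p $ j" "0 < 2 - q $ j" "0 < 2 - r $ j"
    using simplex3_nth_bounds(2)[OF assms(1), of j] simplex3_nth_bounds(2)[OF assms(2), of j]
      simplex3_nth_bounds(2)[OF assms(3), of j] by auto
  have D: "2 - ?x $ j = u * (2 - p $ j) + v * (2 - q $ j) + w * (2 - r $ j)"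
    using uvw(4) by (simp add: algebra_simps)
  have Dpos: "0 < 2 - ?x $ j"
  proof -
    have "u * 1 + v * 1 + w * 1 \<le> u * (2 - p $ j) + v * (2 - q $ j) + w * (2 - r $ j)"
      using uvw assms simplex3_nth_bounds(2)[of _ j] by (intro add_mono mult_left_mono) auto
    then show ?thesis unfolding D using uvw by simp
  qed
  have "T j ?x = (u * (2 - p $ j) / (2 - ?x $ j)) *\<^sub>R T j p + (v * (2 - q $ j) / (2 - ?x $ j)) *\<^sub>R T j q
     + (w * (2 - r $ j) / (2 - ?x $ j)) *\<^sub>R T j r"
    using P Dpos uvw(4) by (auto simp: vec_eq_iff T_nth add_divide_distrib[symmetric])
  moreover have "u * (2 - p $ j) / (2 - ?x $ j) + v * (2 - q $ j) / (2 - ?x $ j)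
     + w * (2 - r $ j) / (2 - ?x $ j) = 1"
    using Dpos unfolding add_divide_distrib[symmetric] D[symmetric] by simp
  moreover have "0 \<le> u * (2 - p $ j) / (2 - ?x $ j)" "0 \<le> v * (2 - q $ j) / (2 - ?x $ j)"
     "0 \<le> w * (2 - r $ j) / (2 - ?x $ j)"
    using P Dpos uvw by simp_all
  ultimately show "y \<in> convex hull {T j p, T j q, T j r}" unfolding y convex_hull_3 by blast
qed

lemma foldr_T_image_convex_hull:
  assumes "p \<in> simplex3" "q \<in> simplex3" "r \<in> simplex3"
  shows "foldr T i ` (convex hull {p, q, r}) \<subseteq> convex hull {foldr T i p, foldr T i q, foldr T i r}"
proof (induction i)
  case (Cons j i)
  have "foldr T (j # i) ` (convex hull {p, q, r}) = T j ` foldr T i ` (convex hull {p, q, r})"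
    by (simp add: image_comp)
  also have "\<dots> \<subseteq> T j ` (convex hull {foldr T i p, foldr T i q, foldr T i r})"
    using Cons by (intro image_mono)
  also have "\<dots> \<subseteq> convex hull {foldr T (j # i) p, foldr T (j # i) q, foldr T (j # i) r}"
    using T_image_convex_hull[of "foldr T i p" "foldr T i q" "foldr T i r" j] assms
    by (simp add: foldr_T_in_simplex3)
  finally show ?case .
qed simp

lemma axis_in_simplex3: "axis k 1 \<in> simplex3"
  using exhaust_3[of k] by (auto simp: simplex3_iff axis_def)

lemma simplex3_eq_hull: "simplex3 = convex hull {axis 1 1, axis 2 1, axis 3 1}"
proof -
  have "x = x $ 1 *\<^sub>R axis 1 1 + x $ 2 *\<^sub>R axis 2 1 + x $ 3 *\<^sub>R axis 3 1" for x :: "real^3"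
    by (auto simp: vec_eq_iff axis_def forall_3)
  then show ?thesis unfolding convex_hull_3
    by (auto simp: simplex3_iff axis_def) blast
qed

lemma cylinder_subset_hull:
  "cylinder w \<subseteq> convex hull {foldr T w (axis 1 1), foldr T w (axis 2 1), foldr T w (axis 3 1)}"
  unfolding cylinder_def simplex3_eq_hull
  by (rule foldr_T_image_convex_hull) (rule axis_in_simplex3)+

section \<open>Hausdorff content\<close>

lemma hausdorff_content_le_diameter:
  assumes "bounded P" "diameter P \<le> e"
  shows "hausdorff_content s e P \<le> ennreal (diameter P powr s)"
proof -
  have e: "0 \<le> e" using diameter_ge_0[OF assms(1)] assms(2) by simp
  \<comment> \<open>The padding is free: the empty set has diameter 0 and
    \<open>0 powr s = 0\<close>.\<close>
  let ?U = "\<lambda>n::nat. if n = 0 then P else {}"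
  have "hausdorff_content s e P \<le> (\<Sum>n. ennreal (diameter (?U n) powr s))"
    unfolding hausdorff_content_def using assms e by (intro INF_lower) (auto split: if_splits)
  also have "\<dots> = (\<Sum>n\<in>{0}. ennreal (diameter (?U n) powr s))"
    by (intro suminf_finite) auto
  finally show ?thesis by simp
qed

lemma hausdorff_content_mono: "A \<subseteq> B \<Longrightarrow> hausdorff_content s e A \<le> hausdorff_content s e B"
  unfolding hausdorff_content_def by (intro INF_superset_mono) auto

lemma hausdorff_content_countable_subadditive:
  "hausdorff_content s e (\<Union>n. A n) \<le> (\<Sum>n. hausdorff_content s e (A (n :: nat)))"
proof (rule ennreal_le_epsilon)
  fix \<eta> :: real assume \<eta>: "0 < \<eta>" and fin: "(\<Sum>n. hausdorff_content s e (A n)) < top"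
  have "\<exists>U. A n \<subseteq> (\<Union>k. U k) \<and> (\<forall>k. bounded (U k) \<and> diameter (U k) \<le> e) \<and>
      (\<Sum>k. ennreal (diameter (U k) powr s)) \<le> hausdorff_content s e (A n) + ennreal (\<eta> * (1/2) ^ Suc n)"
    for n
  proof -
    have "hausdorff_content s e (A n) < top" by (rule ennreal_suminf_lessD[OF fin])
    then have "hausdorff_content s e (A n) < hausdorff_content s e (A n) + ennreal (\<eta> * (1/2) ^ Suc n)"
      using \<eta> by (auto simp: ennreal_add_left_cancel_less[of _ 0, simplified] less_top)
    then show ?thesis unfolding hausdorff_content_def INF_less_iff by (auto intro: less_imp_le)
  qed
  then obtain U where U: "\<And>n. A n \<subseteq> (\<Union>k. U n k)" "\<And>n k. bounded (U n k)" "\<And>n k. diameter (U n k) \<le> e"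
     "\<And>n. (\<Sum>k. ennreal (diameter (U n k) powr s)) \<le> hausdorff_content s e (A n) + ennreal (\<eta> * (1/2) ^ Suc n)"
    by metis
  let ?V = "\<lambda>n. U (fst (prod_decode n)) (snd (prod_decode n))"
  have "(\<Union>n. A n) \<subseteq> (\<Union>n. ?V n)"
  proof
    fix x assume "x \<in> (\<Union>n. A n)"
    then obtain n k where "x \<in> U n k" using U(1) by blast
    then show "x \<in> (\<Union>n. ?V n)" by (auto intro!: exI[of _ "prod_encode (n, k)"])
  qed
  then have "hausdorff_content s e (\<Union>n. A n) \<le> (\<Sum>n. ennreal (diameter (?V n) powr s))"
    unfolding hausdorff_content_def using U by (intro INF_lower) auto
  also have "\<dots> = (\<Sum>n. (\<Sum>k. ennreal (diameter (U n k) powr s)))"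
    by (rule suminf_ennreal_2dimen) (auto simp: o_def split_beta')
  also have "\<dots> \<le> (\<Sum>n. hausdorff_content s e (A n) + ennreal (\<eta> * (1/2) ^ Suc n))"
    using U(4) by (intro suminf_le) auto
  also have "\<dots> = (\<Sum>n. hausdorff_content s e (A n)) + (\<Sum>n. ennreal (\<eta> * (1/2) ^ Suc n))"
    by (intro suminf_add[symmetric]) auto
  also have "(\<Sum>n. ennreal (\<eta> * (1/2) ^ Suc n)) = ennreal \<eta>"
    using sums_mult[OF power_half_series, of \<eta>] \<eta> by (intro suminf_ennreal_eq) auto
  finally show "hausdorff_content s e (\<Union>n. A n) \<le> (\<Sum>n. hausdorff_content s e (A n)) + ennreal \<eta>" .
qed

lemma hausdorff_content_empty: "0 \<le> e \<Longrightarrow> hausdorff_content s e {} = 0"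
  using hausdorff_content_le_diameter[of "{}" e s] by simp

lemma hausdorff_content_finite_subadditive:
  assumes "finite I" "0 \<le> e"
  shows "hausdorff_content s e (\<Union>i\<in>I. A i) \<le> (\<Sum>i\<in>I. hausdorff_content s e (A i))"
proof -
  define n where "n = card I"
  obtain f where f: "bij_betw f {0..<n} I" using ex_bij_betw_nat_finite[OF assms(1)] n_def by blast
  let ?B = "\<lambda>k. if k < n then A (f k) else {}"
  have "(\<Union>i\<in>I. A i) = (\<Union>k. ?B k)"
    using bij_betw_imp_surj_on[OF f] by (force split: if_splits)
  then have "hausdorff_content s e (\<Union>i\<in>I. A i) \<le> (\<Sum>k. hausdorff_content s e (?B k))"
    using hausdorff_content_countable_subadditive[of s e ?B] by simp
  also have "\<dots> = (\<Sum>k\<in>{0..<n}. hausdorff_content s e (?B k))"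
    using assms(2) by (intro suminf_finite) (auto simp: hausdorff_content_empty)
  also have "\<dots> = (\<Sum>k\<in>{0..<n}. hausdorff_content s e (A (f k)))" by (intro sum.cong) auto
  also have "\<dots> = (\<Sum>i\<in>I. hausdorff_content s e (A i))" using f by (rule sum.reindex_bij_betw)
  finally show ?thesis .
qed

lemma hausdorff_content_finite:
  assumes "finite F" "0 \<le> e" shows "hausdorff_content s e F = 0"
proof -
  have "hausdorff_content s e (\<Union>x\<in>F. {x}) \<le> (\<Sum>x\<in>F. hausdorff_content s e {x})"
    by (rule hausdorff_content_finite_subadditive[OF assms])
  also have "\<dots> \<le> (\<Sum>x\<in>F. 0)"
    using hausdorff_content_le_diameter[of "{_}" e s] assms(2) by (intro sum_mono) auto
  finally show ?thesis by simp
qed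

lemma hausdorff_dim_le:
  assumes "0 < s" "\<And>e. 0 < e \<Longrightarrow> hausdorff_content s e A = 0"
  shows "hausdorff_dim A \<le> ennreal s"
  unfolding hausdorff_dim_def hausdorff_measure_def using assms
  by (intro INF_lower) auto

text \<open>Settles the case \<delta> > 1. A grid in the first two coordinates cuts the simplex into
  at most \<open>(n + 1)^2\<close> cells of diameter at most \<open>4 / n\<close>, and the total
  cost tends to 0 because \<open>s > 2\<close>.\<close>

lemma hausdorff_content_simplex3:
  assumes s: "2 < s" and e: "0 < e"
  shows "hausdorff_content s e simplex3 = 0"
proof -
  define cell where "cell = (\<lambda>n (a, b). {x \<in> simplex3. real a \<le> real n * x $ 1 \<and> real n * x $ 1 \<le> real a + 1
      \<and> real b \<le> real n * x $ 2 \<and> real n * x $ 2 \<le> real b + 1})"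
  have diam: "bounded (cell n ab) \<and> diameter (cell n ab) \<le> 4 / real n" if n: "0 < n" for n ab
  proof -
    obtain a b where ab: "ab = (a, b)" by force
    have d: "dist x y \<le> 4 / real n" if "x \<in> cell n ab" "y \<in> cell n ab" for x y
    proof -
      have 1: "\<bar>x $ 1 - y $ 1\<bar> \<le> 1 / real n" "\<bar>x $ 2 - y $ 2\<bar> \<le> 1 / real n"
        using that n by (auto simp: cell_def ab field_simps abs_le_iff)
      have "x $ 3 - y $ 3 = - (x $ 1 - y $ 1) - (x $ 2 - y $ 2)"
        using that by (auto simp: cell_def ab simplex3_iff)
      then have "\<bar>x $ 3 - y $ 3\<bar> \<le> 2 / real n" using 1 by simp
      moreover have "dist x y \<le> (\<Sum>i\<in>UNIV. \<bar>(x - y) $ i\<bar>)" unfolding dist_norm by (rule norm_le_l1_cart)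
      ultimately show ?thesis using 1 by (simp add: sum_3)
    qed
    have "bounded (cell n ab)" unfolding bounded_two_points using d by blast
    moreover have "diameter (cell n ab) \<le> 4 / real n"
      using d by (intro diameter_le) (auto simp: dist_norm)
    ultimately show ?thesis ..
  qed
  have le: "hausdorff_content s e simplex3 \<le> ennreal ((real n + 1)^2 * (4 / real n) powr s)"
    if n: "4 / e \<le> real n" "0 < n" for n
  proof -
    have cov: "simplex3 \<subseteq> (\<Union>ab\<in>{..n} \<times> {..n}. cell n ab)"
    proof
      fix x assume x: "x \<in> simplex3"
      have *: "\<exists>a\<in>{..n}. real a \<le> real n * x $ i \<and> real n * x $ i \<le> real a + 1" for i
      proof (intro bexI[of _ "nat \<lfloor>real n * x $ i\<rfloor>"] conjI)
        have "0 \<le> real n * x $ i" "real n * x $ i \<le> real n * 1"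
          using simplex3_nth_bounds[OF x, of i] by (auto intro: mult_left_mono simp: mult_left_le)
        then show "real (nat \<lfloor>real n * x $ i\<rfloor>) \<le> real n * x $ i"
          "real n * x $ i \<le> real (nat \<lfloor>real n * x $ i\<rfloor>) + 1" "nat \<lfloor>real n * x $ i\<rfloor> \<in> {..n}"
          by (auto simp: nat_le_iff floor_le_iff)
      qed
      from *[of 1] *[of 2] show "x \<in> (\<Union>ab\<in>{..n} \<times> {..n}. cell n ab)"
        using x by (fastforce simp: cell_def)
    qed
    have n4: "4 / real n \<le> e" using n e by (simp add: field_simps)
    have "hausdorff_content s e simplex3 \<le> (\<Sum>ab\<in>{..n} \<times> {..n}. hausdorff_content s e (cell n ab))"
      using hausdorff_content_mono[OF cov] hausdorff_content_finite_subadditive[of "{..n} \<times> {..n}" e s "cell n"] e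
      by (auto intro: order_trans)
    also have "\<dots> \<le> (\<Sum>ab\<in>{..n} \<times> {..n}. ennreal ((4 / real n) powr s))"
    proof (intro sum_mono)
      fix ab
      have "hausdorff_content s e (cell n ab) \<le> ennreal (diameter (cell n ab) powr s)"
        using diam[OF n(2), of ab] n4 by (intro hausdorff_content_le_diameter) auto
      also have "\<dots> \<le> ennreal ((4 / real n) powr s)"
        using diam[OF n(2), of ab] s by (intro ennreal_leI powr_mono2 diameter_ge_0) auto
      finally show "hausdorff_content s e (cell n ab) \<le> ennreal ((4 / real n) powr s)" .
    qed
    also have "\<dots> = ennreal ((real n + 1)^2 * (4 / real n) powr s)"
      by (simp add: ennreal_mult power2_eq_square ennreal_of_nat_eq_real_of_nat card_cartesian_product algebra_simps)
    finally show ?thesis .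
  qed
  have "(\<lambda>n. (real n + 1)^2 * (4 / real n) powr s) \<longlonglongrightarrow> 0"
    using s by real_asymp
  then have "(\<lambda>n. ennreal ((real n + 1)^2 * (4 / real n) powr s)) \<longlonglongrightarrow> ennreal 0"
    by (rule tendsto_ennrealI)
  moreover have "eventually (\<lambda>n. hausdorff_content s e simplex3 \<le> ennreal ((real n + 1)^2 * (4 / real n) powr s)) sequentially"
    unfolding eventually_sequentially
    by (intro exI[of _ "nat \<lceil>4 / e\<rceil> + 1"] allI impI le) linarith+
  ultimately have "hausdorff_content s e simplex3 \<le> ennreal 0"
    by (rule tendsto_lowerbound) simp
  then show ?thesis by simp
qed

text \<open>With \<open>p q\<close> the longest side, of length \<open>d\<close>, the triangle is
  cut across that side into about \<open>d / H\<close> strips of width \<open>H\<close>, where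
  \<open>H\<close> is at least the height. Their cost is of order
  \<open>d * H powr \<delta>\<close>, which is
  \<open>d powr (1 - \<delta>) * (d * H) powr \<delta>\<close>, and \<open>d * H\<close> is at most
  \<open>E\<close>.\<close>

lemma hausdorff_content_triangle:
  fixes p q r :: "real^3"
  assumes \<delta>: "0 < \<delta>" "\<delta> \<le> 1" and L: "dist p r \<le> dist p q" "dist q r \<le> dist p q" "dist p q \<le> L" "0 < L"
    and E: "norm (cross3 (q - p) (r - p)) \<le> E" "0 < E" and e: "2 * L \<le> e"
  shows "hausdorff_content (1 + \<delta>) e (convex hull {p, q, r}) \<le> ennreal (12 * L powr (1 - \<delta>) * E powr \<delta>)"
proof (cases "p = q")
  case True
  then have "r = p" using L by simp
  then have "convex hull {p, q, r} = {p}" using True by simp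
  then show ?thesis using hausdorff_content_finite[of "{p}" e "1 + \<delta>"] e L by simp
next
  case False
  define d where "d = dist p q"
  define u where "u = q - p"
  define v where "v = r - p"
  have d: "0 < d" "d \<le> L" and nu: "norm u = d" using False L by (auto simp: d_def u_def dist_norm norm_minus_commute)
  \<comment> \<open>\<open>t\<close> locates the foot of the perpendicular from \<open>r\<close> on
    the line \<open>p q\<close>, and \<open>h\<close> is the height. As \<open>p q\<close> is the
    longest side, the foot lies on the side itself.\<close>
  define t where "t = (u \<bullet> v) / d^2"
  define h where "h = norm (v - t *\<^sub>R u)"
  have uu: "u \<bullet> u = d^2" using nu by (simp add: power2_norm_eq_inner[symmetric])
  have "h^2 = v \<bullet> v - 2 * t * (u \<bullet> v) + t^2 * (u \<bullet> u)"
    unfolding h_def power2_norm_eq_inner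
    by (simp add: inner_diff_left inner_diff_right inner_commute uu power2_eq_square)
  then have "h^2 * d^2 = (v \<bullet> v) * d^2 - (u \<bullet> v)^2"
    using d unfolding t_def uu by (simp add: power_mult_distrib power2_eq_square field_simps)
  also have "(v \<bullet> v) * d^2 = (norm v * d)^2" by (simp add: power_mult_distrib power2_norm_eq_inner)
  also have "(norm v * d)^2 - (u \<bullet> v)^2 = (norm (cross3 u v))^2"
    using norm_cross_dot[of u v] nu by (simp add: mult.commute)
  finally have "(h * d)^2 = (norm (cross3 u v))^2" by (simp add: power_mult_distrib)
  then have hd: "h * d = norm (cross3 u v)"
    using d by (subst (asm) power2_eq_iff_nonneg) (auto simp: h_def)
  have t01: "0 \<le> t" "t \<le> 1"
  proof -
    have "(norm (r - q))^2 \<le> d^2" "(norm v)^2 \<le> d^2"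
      using L d by (auto simp: d_def dist_norm v_def norm_minus_commute intro!: power_mono)
    moreover have "r - q = v - u" by (simp add: u_def v_def)
    ultimately have "v \<bullet> v - 2 * (u \<bullet> v) + u \<bullet> u \<le> d^2" "v \<bullet> v \<le> d^2"
      by (auto simp: power2_norm_eq_inner inner_diff_left inner_diff_right inner_commute)
    then have "0 \<le> u \<bullet> v" using uu inner_ge_zero[of v] by linarith
    then show "0 \<le> t" using d by (simp add: t_def)
    have "u \<bullet> v \<le> norm u * norm v" by (rule norm_cauchy_schwarz)
    also have "\<dots> \<le> d * d" using nu L d by (intro mult_mono) (auto simp: d_def v_def dist_norm norm_minus_commute)
    finally show "t \<le> 1" using d by (simp add: t_def power2_eq_square)
  qed
  \<comment> \<open>Using the bound \<open>E\<close> instead of the true area keeps \<open>H\<close>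
    positive for degenerate triangles; the cap \<open>d\<close> ensures
    \<open>1 \<le> d / H\<close>.\<close>
  define H where "H = min d (E / d)"
  have H: "0 < H" "H \<le> d" "d * H \<le> E" using d E by (auto simp: H_def min_def field_simps)
  have hH: "h \<le> H"
  proof -
    have "h * d \<le> E" "h * d \<le> d * d"
    proof -
      show "h * d \<le> E" using hd E by (simp add: u_def v_def)
      have "norm v \<le> d" using L by (simp add: d_def v_def dist_norm norm_minus_commute)
      have "(h * d)^2 \<le> (norm u * norm v)^2" unfolding hd norm_cross_dot[symmetric] by simp
      also have "\<dots> \<le> (d * d)^2" using nu d \<open>norm v \<le> d\<close> by (intro power_mono mult_mono) auto
      finally show "h * d \<le> d * d" by (rule power2_le_imp_le) (use d in simp)
    qed
    then show ?thesis using d by (auto simp: H_def field_simps)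
  qed
  define K where "K = nat \<lceil>d / H\<rceil>"
  have dH1: "1 \<le> d / H" using H d by simp
  have K: "d / H \<le> real K" "real K \<le> d / H + 1"
    using dH1 unfolding K_def by linarith+
  \<comment> \<open>Rectangles over consecutive intervals of length \<open>H\<close> on the line
    \<open>p q\<close>; \<open>a\<close> runs along the side and \<open>c\<close> along the
    height.\<close>
  define P where "P = (\<lambda>k::nat. {p + a *\<^sub>R u + c *\<^sub>R (v - t *\<^sub>R u) | a c.
      real k * H \<le> a * d \<and> a * d \<le> real (Suc k) * H \<and> 0 \<le> c \<and> c \<le> 1})"
  have dist: "dist x y \<le> 2 * H" if xy: "x \<in> P k" "y \<in> P k" for x y k
  proof -
    obtain a c where x: "x = p + a *\<^sub>R u + c *\<^sub>R (v - t *\<^sub>R u)" "real k * H \<le> a * d"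
        "a * d \<le> real (Suc k) * H" "0 \<le> c" "c \<le> 1"
      using xy(1) unfolding P_def by blast
    obtain a' c' where y: "y = p + a' *\<^sub>R u + c' *\<^sub>R (v - t *\<^sub>R u)" "real k * H \<le> a' * d"
        "a' * d \<le> real (Suc k) * H" "0 \<le> c'" "c' \<le> 1"
      using xy(2) unfolding P_def by blast
    have "x - y = (a - a') *\<^sub>R u + (c - c') *\<^sub>R (v - t *\<^sub>R u)"
      by (simp add: x(1) y(1) algebra_simps)
    then have "dist x y \<le> \<bar>a - a'\<bar> * d + \<bar>c - c'\<bar> * h"
      unfolding dist_norm using norm_triangle_ineq[of "(a - a') *\<^sub>R u" "(c - c') *\<^sub>R (v - t *\<^sub>R u)"]
      by (simp add: nu h_def)
    also have "\<bar>a - a'\<bar> * d = \<bar>a * d - a' * d\<bar>" using d abs_mult[of "a - a'" d] by (simp add: algebra_simps)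
    also have "\<dots> \<le> H" using x y by (simp add: abs_le_iff algebra_simps)
    also have "\<bar>c - c'\<bar> * h \<le> 1 * H" using x y hH by (intro mult_mono) (auto simp: h_def)
    finally show ?thesis by simp
  qed
  have bP: "bounded (P k)" "diameter (P k) \<le> 2 * H" for k
    using dist[of _ k] H unfolding bounded_two_points
    by (blast, intro diameter_le) (auto simp: dist_norm)
  have cov: "convex hull {p, q, r} \<subseteq> (\<Union>k\<in>{..K}. P k)"
  proof
    fix x assume "x \<in> convex hull {p, q, r}"
    then obtain \<alpha> \<beta> \<gamma> where c: "0 \<le> \<alpha>" "0 \<le> \<beta>" "0 \<le> \<gamma>" "\<alpha> + \<beta> + \<gamma> = 1" and
      x: "x = \<alpha> *\<^sub>R p + \<beta> *\<^sub>R q + \<gamma> *\<^sub>R r" unfolding convex_hull_3 by blast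
    define a where "a = \<beta> + \<gamma> * t"
    have \<alpha>: "\<alpha> = 1 - \<beta> - \<gamma>" using c by simp
    have xe: "x = p + a *\<^sub>R u + \<gamma> *\<^sub>R (v - t *\<^sub>R u)"
      unfolding x a_def u_def v_def \<alpha> by (simp add: algebra_simps)
    have "\<gamma> * t \<le> \<gamma>" using c t01 by (simp add: mult_left_le)
    then have a: "0 \<le> a" "a \<le> 1" using c t01 by (auto simp: a_def)
    define k where "k = nat \<lfloor>a * d / H\<rfloor>"
    have "0 \<le> a * d / H" using a d H by simp
    then have "real k \<le> a * d / H" "a * d / H \<le> real (Suc k)" unfolding k_def by linarith+
    then have k: "real k * H \<le> a * d" "a * d \<le> real (Suc k) * H" using H by (auto simp: field_simps)
    have "a * d / H \<le> d / H" using a d H by (intro divide_right_mono) (auto simp: mult_left_le_one_le)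
    then have "real k \<le> real K" using \<open>real k \<le> a * d / H\<close> K by linarith
    then have "k \<in> {..K}" by simp
    moreover have "x \<in> P k" unfolding P_def
      by (intro CollectI exI[of _ a] exI[of _ \<gamma>] conjI) (use xe k c in auto)
    ultimately show "x \<in> (\<Union>k\<in>{..K}. P k)" by blast
  qed
  have e0: "0 \<le> e" using e L by simp
  have "hausdorff_content (1 + \<delta>) e (convex hull {p, q, r}) \<le> (\<Sum>k\<in>{..K}. hausdorff_content (1 + \<delta>) e (P k))"
    using hausdorff_content_mono[OF cov] hausdorff_content_finite_subadditive[of "{..K}" e "1 + \<delta>" P] e0
    by (auto intro: order_trans)
  also have "\<dots> \<le> (\<Sum>k\<in>{..K}. ennreal ((2 * H) powr (1 + \<delta>)))"
  proof (intro sum_mono)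
    fix k
    have "hausdorff_content (1 + \<delta>) e (P k) \<le> ennreal (diameter (P k) powr (1 + \<delta>))"
      using bP[of k] H d e by (intro hausdorff_content_le_diameter) auto
    also have "\<dots> \<le> ennreal ((2 * H) powr (1 + \<delta>))"
      using bP[of k] \<delta> by (intro ennreal_leI powr_mono2 diameter_ge_0) auto
    finally show "hausdorff_content (1 + \<delta>) e (P k) \<le> ennreal ((2 * H) powr (1 + \<delta>))" .
  qed
  also have "\<dots> = ennreal ((real K + 1) * (2 * H) powr (1 + \<delta>))"
    by (simp add: ennreal_mult ennreal_of_nat_eq_real_of_nat algebra_simps)
  also have "\<dots> \<le> ennreal (12 * L powr (1 - \<delta>) * E powr \<delta>)"
  proof (rule ennreal_leI)
    \<comment> \<open>The constant 12 is 3 times 4: since \<open>1 \<le> d / H\<close>, there are at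
      most \<open>3 * (d / H)\<close> pieces, and \<open>2 powr (1 + \<delta>)\<close> is at most
      4.\<close>
    have "(real K + 1) * (2 * H) powr (1 + \<delta>) \<le> (3 * (d / H)) * (2 * H) powr (1 + \<delta>)"
      using K dH1 by (intro mult_right_mono) auto
    also have "\<dots> = (3 * (d / H)) * (2 powr (1 + \<delta>) * (H * H powr \<delta>))"
      using H by (simp add: powr_mult powr_add)
    also have "\<dots> \<le> (3 * (d / H)) * (2 powr 2 * (H * H powr \<delta>))"
      using H d \<delta> by (intro mult_left_mono mult_right_mono powr_mono) auto
    also have "\<dots> = 12 * (d * H powr \<delta>)" using H by simp
    also have "d = d powr (1 - \<delta>) * d powr \<delta>" using d by (simp add: powr_add[symmetric])
    also have "\<dots> * H powr \<delta> = d powr (1 - \<delta>) * (d * H) powr \<delta>" using d H by (simp add: powr_mult)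
    also have "\<dots> \<le> L powr (1 - \<delta>) * E powr \<delta>"
      using d H \<delta> by (intro mult_mono powr_mono2) auto
    finally show "(real K + 1) * (2 * H) powr (1 + \<delta>) \<le> 12 * L powr (1 - \<delta>) * E powr \<delta>" by simp
  qed
  finally show ?thesis .
qed

section \<open>Types of words\<close>

text \<open>The state of a word seen by \<open>matD\<close>: its beginning up to a renaming of
  letters, since renaming only permutes coordinates. An initial run of at least \<open>m\<close>
  equal letters is recorded by its exact length instead.\<close>

definition of_type :: "nat \<Rightarrow> index \<Rightarrow> 3 list \<Rightarrow> bool" where
  "of_type m \<alpha> y = (case \<alpha> of
     Word v \<Rightarrow> v \<in> words m \<and> (\<exists>\<pi>. bij \<pi> \<and> take (m + 1) y = map \<pi> v)
   | Num k \<Rightarrow> m \<le> k \<and> (\<exists>a b u. a \<noteq> b \<and> y = replicate k a @ b # u))"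

lemma run_decomposition_unique:
  assumes "replicate k a @ b # u = replicate k' a' @ b' # u'" "1 \<le> k" "1 \<le> k'" "a \<noteq> b" "a' \<noteq> b'"
  shows "k = k'" "a = a'" "b = b'" "u = u'"
proof -
  have aa: "a = a'" using assms by (cases k; cases k') auto
  have "k = k' \<and> b = b' \<and> u = u'"
    using assms(1,4,5) unfolding aa
  proof (induction k arbitrary: k')
    case 0 then show ?case by (cases k') auto
  next
    case (Suc k) then show ?case by (cases k') auto
  qed
  then show "k = k'" "a = a'" "b = b'" "u = u'" using aa by auto
qed

lemma mem_wordsE:
  assumes "v \<in> words m"
  obtains k u where "v = replicate k 1 @ 2 # u" "1 \<le> k" "k + 1 \<le> m" "length u = m - k"
  using assms unfolding words_def words_k_def by auto

lemma mem_wordsI: "1 \<le> k \<Longrightarrow> k + 1 \<le> m \<Longrightarrow> length u = m - k \<Longrightarrow> replicate k 1 @ 2 # u \<in> words m"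
  unfolding words_def words_k_def by (intro UN_I[of k]) auto

lemma length_words: "v \<in> words m \<Longrightarrow> length v = m + 1"
  by (elim mem_wordsE) auto

lemma finite_words: "finite (words m)"
proof (rule finite_subset)
  show "words m \<subseteq> {v. set v \<subseteq> UNIV \<and> length v = m + 1}" using length_words by auto
  show "finite {v :: 3 list. set v \<subseteq> UNIV \<and> length v = m + 1}" by (rule finite_lists_length_eq) simp
qed

lemma star_mem_words: assumes "2 \<le> m" shows "star m \<in> words m"
proof -
  have "star m = replicate 1 1 @ 2 # replicate (m - 1) 2"
    using assms unfolding star_def by (cases m) auto
  then show ?thesis using mem_wordsI[of 1 m "replicate (m - 1) 2"] assms by simp
qed

lemma bij3_eq_id:
  fixes \<sigma> :: "3 \<Rightarrow> 3"
  assumes "bij \<sigma>" "\<sigma> a = a" "\<sigma> b = b" "a \<noteq> b" shows "\<sigma> = id"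
proof
  fix x
  have inj: "\<sigma> x = \<sigma> y \<longleftrightarrow> x = y" for x y using assms(1) by (auto simp: bij_def inj_eq)
  show "\<sigma> x = id x"
    using assms(2-4) inj[of x a] inj[of x b] exhaust_3[of x] exhaust_3[of a] exhaust_3[of b]
      exhaust_3[of "\<sigma> x"] by auto
qed

lemma ex_bij3:
  fixes a b :: 3 assumes "a \<noteq> b" obtains \<pi> :: "3 \<Rightarrow> 3" where "bij \<pi>" "\<pi> 1 = a" "\<pi> 2 = b"
proof -
  obtain c where c: "c \<noteq> a" "c \<noteq> b"
  proof -
    have "card {a, b} \<noteq> card (UNIV :: 3 set)" using assms by simp
    then have "UNIV \<noteq> {a, b}" by metis
    then show ?thesis using that by blast
  qed
  define \<pi> where "\<pi> = (\<lambda>i::3. if i = 1 then a else if i = 2 then b else c)"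
  have "inj \<pi>" unfolding inj_def forall_3 using assms c by (auto simp: \<pi>_def)
  then have "bij \<pi>" by (simp add: bij_def finite_UNIV_inj_surj)
  then show ?thesis using that by (simp add: \<pi>_def)
qed

lemma of_type_length: "of_type m \<alpha> y \<Longrightarrow> m + 1 \<le> length y"
proof (cases \<alpha>)
  case (Word v)
  assume "of_type m \<alpha> y"
  then obtain \<pi> where "v \<in> words m" "take (m + 1) y = map \<pi> v" by (auto simp: of_type_def Word)
  then have "length (take (m + 1) y) = m + 1" by (simp add: length_words)
  then show ?thesis by simp
qed (auto simp: of_type_def)

lemma of_type_indices: "of_type m \<alpha> y \<Longrightarrow> \<alpha> \<in> indices m"
  by (cases \<alpha>) (auto simp: of_type_def indices_def)

lemma of_type_map:
  assumes "bij \<pi>" "of_type m \<alpha> y" shows "of_type m \<alpha> (map \<pi> y)"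
proof (cases \<alpha>)
  case (Word v)
  then obtain \<sigma> where "v \<in> words m" "bij \<sigma>" "take (m + 1) y = map \<sigma> v"
    using assms by (auto simp: of_type_def)
  moreover from this have "bij (\<pi> \<circ> \<sigma>)" "take (m + 1) (map \<pi> y) = map (\<pi> \<circ> \<sigma>) v"
    using assms(1) by (auto intro: bij_comp simp del: take_Suc_conv_app_nth simp: take_map)
  ultimately show ?thesis using Word by (auto simp: of_type_def)
next
  case (Num k)
  then obtain a b u where "m \<le> k" "a \<noteq> b" "y = replicate k a @ b # u"
    using assms by (auto simp: of_type_def)
  moreover from this have "\<pi> a \<noteq> \<pi> b" using assms(1) by (auto simp: bij_def inj_eq)
  moreover have "map \<pi> (replicate k a @ b # u) = replicate k (\<pi> a) @ \<pi> b # map \<pi> u" by simp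
  ultimately show ?thesis using Num unfolding of_type_def by auto
qed

lemma of_type_append:
  assumes "of_type m \<alpha> y" shows "of_type m \<alpha> (y @ z)"
  using assms of_type_length[OF assms] by (cases \<alpha>) (auto simp: of_type_def)

lemma of_type_WordD:
  assumes "of_type m (Word v) y"
  obtains k u and \<pi> :: "3 \<Rightarrow> 3" where "v = replicate k 1 @ 2 # u" "1 \<le> k" "k + 1 \<le> m" "length u = m - k" "bij \<pi>"
    "y = replicate k (\<pi> 1) @ \<pi> 2 # (map \<pi> u @ drop (m + 1) y)"
proof -
  from assms obtain \<pi> where v: "v \<in> words m" and \<pi>: "bij \<pi>" "take (m + 1) y = map \<pi> v"
    by (auto simp: of_type_def)
  obtain k u where ku: "v = replicate k 1 @ 2 # u" "1 \<le> k" "k + 1 \<le> m" "length u = m - k"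
    using v by (rule mem_wordsE)
  have "y = map \<pi> v @ drop (m + 1) y" unfolding \<pi>(2)[symmetric] by (rule append_take_drop_id[symmetric])
  then have "y = replicate k (\<pi> 1) @ \<pi> 2 # (map \<pi> u @ drop (m + 1) y)" by (simp add: ku(1))
  with that[OF ku \<pi>(1)] show ?thesis .
qed

lemma bij3_neq: "bij (\<pi> :: 3 \<Rightarrow> 3) \<Longrightarrow> \<pi> 1 \<noteq> \<pi> 2"
  by (auto simp: bij_def inj_eq)

text \<open>The length of the initial run is below \<open>m\<close> for a \<open>Word\<close> type
  and equals the index for a \<open>Num\<close> type. For two \<open>Word\<close> types, the first
  two distinct letters of \<open>y\<close> determine the renaming.\<close>

lemma of_type_unique:
  assumes "2 \<le> m" "of_type m \<alpha> y" "of_type m \<beta> y" shows "\<alpha> = \<beta>"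
proof -
  have WN: False if "of_type m (Word v) y" "of_type m (Num k) y" for v k
  proof -
    from that(1) obtain l u and \<pi> :: "3 \<Rightarrow> 3" where l: "l + 1 \<le> m" "1 \<le> l" "bij \<pi>"
      "y = replicate l (\<pi> 1) @ \<pi> 2 # (map \<pi> u @ drop (m + 1) y)" by (rule of_type_WordD)
    from that(2) obtain a b u' where k: "m \<le> k" "a \<noteq> b" "y = replicate k a @ b # u'"
      by (auto simp: of_type_def)
    have "k = l"
      by (rule run_decomposition_unique(1)[OF trans[OF k(3)[symmetric] l(4)]])
        (use l k bij3_neq[OF l(3)] in auto)
    then show False using l k by simp
  qed
  have NN: "k = l" if "of_type m (Num k) y" "of_type m (Num l) y" for k l
    using that assms(1) by (auto simp: of_type_def intro: run_decomposition_unique(1))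
  have WW: "v = v'" if "of_type m (Word v) y" "of_type m (Word v') y" for v v'
  proof -
    from that(1) obtain l u \<pi> where l: "v = replicate l 1 @ 2 # u" "1 \<le> l" "l + 1 \<le> m" "length u = m - l"
      "bij \<pi>" "y = replicate l (\<pi> 1) @ \<pi> 2 # (map \<pi> u @ drop (m + 1) y)" by (rule of_type_WordD)
    from that(2) obtain l' u' \<sigma> where l': "v' = replicate l' 1 @ 2 # u'" "1 \<le> l'" "l' + 1 \<le> m" "length u' = m - l'"
      "bij \<sigma>" "y = replicate l' (\<sigma> 1) @ \<sigma> 2 # (map \<sigma> u' @ drop (m + 1) y)" by (rule of_type_WordD)
    note eq = run_decomposition_unique[OF trans[OF l(6)[symmetric] l'(6)] l(2) l'(2)
       bij3_neq[OF l(5)] bij3_neq[OF l'(5)]]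
    have uu: "map \<pi> u = map \<sigma> u'" using eq(1,4) l l' by simp
    have "inv \<sigma> \<circ> \<pi> = id"
    proof (rule bij3_eq_id)
      show "bij (inv \<sigma> \<circ> \<pi>)" using l(5) l'(5) by (intro bij_comp bij_imp_bij_inv)
      show "(inv \<sigma> \<circ> \<pi>) 1 = 1" "(inv \<sigma> \<circ> \<pi>) 2 = 2"
        using eq l'(5) by (auto simp: bij_def inv_f_f)
    qed simp
    then have "map (inv \<sigma> \<circ> \<pi>) u = u" by simp
    also have "map (inv \<sigma> \<circ> \<pi>) u = map (inv \<sigma>) (map \<sigma> u')" unfolding uu[symmetric] by simp
    also have "\<dots> = u'" using l'(5) by (simp add: bij_def inv_o_cancel)
    finally show ?thesis using l l' eq(1) by simp
  qed
  show ?thesis using assms WN NN WW by (cases \<alpha>; cases \<beta>) metis+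
qed

section \<open>Adjacency as the change of type under a prepended letter\<close>

lemma ex_adj:
  assumes "v \<in> words m" shows "\<exists>\<alpha>. adj m j (Word v) \<alpha>"
proof -
  obtain k u where ku: "v = replicate k 1 @ 2 # u" "1 \<le> k" "k + 1 \<le> m" "length u = m - k"
    using assms by (rule mem_wordsE)
  show ?thesis
  proof (cases "j = 1")
    case True
    then show ?thesis using adj.grow[of k m u] adj.exit[of k m u] ku by (cases "k + 2 \<le> m") auto
  next
    case False
    \<comment> \<open>This renaming normalises a word that starts with \<open>j\<close> followed by
      the letter 1: its image starts with 1, 2 and so has an initial run of length 1.\<close>
    define \<sigma> where "\<sigma> = (\<lambda>i::3. if i = j then 1 else if i = 1 then 2 else 3 :: 3)"
    have "inj \<sigma>" unfolding inj_def forall_3 using False exhaust_3[of j] by (auto simp: \<sigma>_def)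
    then have \<sigma>: "bij \<sigma>" by (simp add: bij_def finite_UNIV_inj_surj)
    let ?w = "j # replicate k 1 @ 2 # butlast u"
    have "map \<sigma> ?w = 1 # replicate k 2 @ map \<sigma> (2 # butlast u)"
      using False by (simp add: \<sigma>_def)
    also have "\<dots> = replicate 1 1 @ 2 # (replicate (k - 1) 2 @ map \<sigma> (2 # butlast u))"
      using ku(2) by (cases k) auto
    finally have "map \<sigma> ?w \<in> words_k m 1"
      unfolding words_k_def using ku by (intro CollectI exI conjI) auto
    moreover have "word_equiv (map \<sigma> ?w) ?w" unfolding word_equiv_def
      using \<sigma> by (intro exI[of _ "inv \<sigma>"]) (auto simp: bij_imp_bij_inv bij_is_inj)
    moreover have "j \<in> {2, 3}" using False exhaust_3[of j] by auto
    ultimately show ?thesis using adj.restart[of j k m u "map \<sigma> ?w"] ku by blast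
  qed
qed

text \<open>Prepending a letter pushes the last letter out of the window of length
  \<open>m + 1\<close>, hence the \<open>butlast\<close> in \<open>adj\<close>. In the
  \<open>exit\<close> case the run of ones has reached length \<open>m\<close>.\<close>

lemma adj_of_type:
  assumes "adj m j (Word v) \<alpha>" shows "of_type m \<alpha> (j # v)"
  using assms
proof cases
  case (grow k u)
  have "take (m - k) u = u" "take (m - k - 1) u = butlast u" using grow by (auto simp: butlast_conv_take)
  then have "take (m + 1) (j # v) = replicate (k + 1) 1 @ 2 # butlast u"
    using grow by (simp add: take_Cons' Suc_diff_le)
  moreover have "replicate (k + 1) 1 @ 2 # butlast u \<in> words m"
    using grow by (intro mem_wordsI) auto
  ultimately show ?thesis using grow by (auto simp: of_type_def intro!: exI[of _ id])
next
  case (exit k u)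
  then have "j # v = replicate m 1 @ 2 # u" by (simp flip: exit(5))
  then have "\<exists>a b u'. a \<noteq> b \<and> j # v = replicate m a @ b # u'"
    by (intro exI[of _ 1] exI[of _ 2] exI[of _ u]) simp
  moreover have "\<alpha> = Num m" using exit by simp
  ultimately show ?thesis by (simp only: of_type_def index.case le_refl simp_thms)
next
  case (restart k u v')
  have "take (m - k) u = u" "take (m - k - 1) u = butlast u" using restart by (auto simp: butlast_conv_take)
  then have "take (m + 1) (j # v) = j # replicate k 1 @ 2 # butlast u"
    using restart by (simp add: take_Cons' Suc_diff_le)
  moreover have "v' \<in> words m" using restart unfolding words_def by (intro UN_I[of 1]) auto
  ultimately show ?thesis using restart by (auto simp: of_type_def word_equiv_def)
qed

text \<open>Makes the \<open>THE\<close> in \<open>matB\<close> meaningful. A renaming relating the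
  two extensions fixes the first \<open>m\<close> letters of \<open>v\<close>, among which are 1 and
  2, so it is the identity. For a \<open>Num\<close> type the new letter must repeat the head of
  \<open>v\<close>.\<close>

lemma of_type_Cons_unique:
  assumes m: "2 \<le> m" and v: "v \<in> words m" and "of_type m \<alpha> (j # v)" "of_type m \<alpha> (j' # v)"
  shows "j = j'"
proof (cases \<alpha>)
  case (Num k)
  have *: "i = hd v" if "of_type m \<alpha> (i # v)" for i
  proof -
    from that obtain a b u where "m \<le> k" "i # v = replicate k a @ b # u" by (auto simp: of_type_def Num)
    then show ?thesis using m by (cases k; cases "k - 1") auto
  qed
  show ?thesis using *[OF assms(3)] *[OF assms(4)] by simp
next
  case (Word w)
  obtain k u where ku: "v = replicate k 1 @ 2 # u" "1 \<le> k" "k + 1 \<le> m" "length u = m - k"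
    using v by (rule mem_wordsE)
  have mem: "1 \<in> set (take m v)" "2 \<in> set (take m v)"
    using ku by (auto simp: take_Cons' Suc_diff_le)
  obtain \<pi> where \<pi>: "bij \<pi>" "j # take m v = map \<pi> w" using assms(3) Word by (auto simp: of_type_def)
  obtain \<sigma> where \<sigma>: "bij \<sigma>" "j' # take m v = map \<sigma> w" using assms(4) Word by (auto simp: of_type_def)
  have w: "w = map (inv \<pi>) (j # take m v)" using \<pi> by (simp add: bij_def inv_o_cancel)
  have eq: "map (\<sigma> \<circ> inv \<pi>) (j # take m v) = j' # take m v" using \<sigma>(2) w by simp
  then have "map (\<sigma> \<circ> inv \<pi>) (take m v) = map id (take m v)" by simp
  then have "\<forall>x\<in>set (take m v). (\<sigma> \<circ> inv \<pi>) x = x" unfolding map_eq_conv by simp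
  then have "\<sigma> \<circ> inv \<pi> = id"
    using mem \<pi>(1) \<sigma>(1) by (intro bij3_eq_id[of _ 1 2] bij_comp bij_imp_bij_inv) auto
  then show ?thesis using eq by simp
qed

section \<open>Domination by powers of the matrix\<close>

text \<open>The symmetry of the system that belongs to a renaming \<pi>: it conjugates
  \<open>T (\<pi> j)\<close> to \<open>T j\<close> and moves points from the cylinder of a renamed
  word to that of the original one.\<close>

definition pcoord :: "(3 \<Rightarrow> 3) \<Rightarrow> real^3 \<Rightarrow> real^3" where
  "pcoord \<pi> x = (\<chi> i. x $ \<pi> i)"

lemma pcoord_T: "bij \<pi> \<Longrightarrow> pcoord \<pi> (T (\<pi> j) x) = T j (pcoord \<pi> x)"
  by (auto simp: vec_eq_iff pcoord_def T_nth bij_def inj_eq)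

lemma pcoord_simplex3:
  assumes "bij \<pi>" "x \<in> simplex3" shows "pcoord \<pi> x \<in> simplex3"
proof -
  have "(\<Sum>i\<in>UNIV. x $ \<pi> i) = (\<Sum>i\<in>UNIV. x $ i)"
    by (rule sum.reindex_bij_betw[OF assms(1)])
  then show ?thesis using assms(2) by (auto simp: simplex3_def pcoord_def)
qed

lemma pcoord_foldr_T: "bij \<pi> \<Longrightarrow> pcoord \<pi> (foldr T (map \<pi> w) x) = foldr T w (pcoord \<pi> x)"
  by (induction w) (auto simp: pcoord_T)

lemma pcoord_cylinder: "bij \<pi> \<Longrightarrow> x \<in> cylinder (map \<pi> w) \<Longrightarrow> pcoord \<pi> x \<in> cylinder w"
  by (auto simp: cylinder_def pcoord_foldr_T pcoord_simplex3)

text \<open>In the variable \<open>t = 1 - x $ a\<close> the map \<open>T a\<close> reads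
  \<open>t / (1 + t)\<close>, so its iterates are \<open>t / (1 + k * t)\<close>.\<close>

lemma foldr_T_replicate_nth:
  assumes "z \<in> simplex3"
  shows "1 - foldr T (replicate k a) z $ a = (1 - z $ a) / (1 + real k * (1 - z $ a))"
proof (induction k)
  case (Suc k)
  define y where "y = foldr T (replicate k a) z"
  define t where "t = 1 - z $ a"
  have t: "0 \<le> t" using simplex3_nth_bounds[OF assms, of a] by (simp add: t_def)
  have p: "0 < 1 + real k * t" "0 < 1 + real (Suc k) * t" using t by (auto intro!: add_pos_nonneg)
  have ya: "1 - y $ a = t / (1 + real k * t)" using Suc by (simp add: y_def t_def)
  have "1 - foldr T (replicate (Suc k) a) z $ a = 1 - 1 / (1 + (1 - y $ a))"
    by (simp add: y_def T_nth)
  also have "\<dots> = t / (1 + real (Suc k) * t)"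
    unfolding ya using p t by (simp add: field_simps)
  finally show ?case by (simp add: t_def)
qed simp

text \<open>Before the run, coordinate \<open>b\<close> is at least \<open>1 / 2\<close>, so
  \<open>t\<close> lies between \<open>1 / 2\<close> and 1. The bounds are the values of the
  increasing function \<open>t / (1 + k * t)\<close> at these two ends.\<close>

lemma run_cylinder_bounds:
  assumes "x \<in> cylinder (replicate k a @ b # u)" "a \<noteq> b"
  shows "1 / (real k + 2) \<le> 1 - x $ a" "1 - x $ a \<le> 1 / (real k + 1)"
proof -
  obtain y where y: "y \<in> cylinder u" "x = foldr T (replicate k a) (T b y)"
    using assms(1) unfolding cylinder_append cylinder_Cons by auto
  have ys: "T b y \<in> simplex3" using y cylinder_subset_simplex3 by (auto intro: T_in_simplex3)
  define t where "t = 1 - T b y $ a"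
  have "T b y $ a + T b y $ b \<le> 1"
    using ys assms(2) exhaust_3[of a] exhaust_3[of b] by (auto simp: simplex3_iff)
  moreover have "1 / 2 \<le> T b y $ b" using y cylinder_subset_simplex3 by (intro T_nth_ge_half) auto
  ultimately have t: "1 / 2 \<le> t" "t \<le> 1" using simplex3_nth_bounds[OF ys, of a] by (auto simp: t_def)
  have p: "0 < 1 + real k * t" using t by (auto intro!: add_pos_nonneg)
  have x: "1 - x $ a = t / (1 + real k * t)"
    using foldr_T_replicate_nth[OF ys, of k a] y by (simp add: t_def)
  show "1 / (real k + 2) \<le> 1 - x $ a" "1 - x $ a \<le> 1 / (real k + 1)"
    unfolding x using p t by (auto simp: field_simps)
qed

lemma sum_powr_le_extreme:
  fixes x y p :: real
  assumes "0 \<le> x" "0 \<le> y" "x + y < 2" "0 \<le> p"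
  shows "(2 - x) powr (- p) + (2 - y) powr (- p) \<le> 2 powr (- p) + (2 - x - y) powr (- p)"
proof -
  define A where "A = (2 - x) powr (- p)"
  define B where "B = (2 - y) powr (- p)"
  define C where "C = 2 powr (- p)"
  define D where "D = (2 - x - y) powr (- p)"
  have A0: "0 < A" using assms by (simp add: A_def)
  have CA: "C \<le> A" unfolding C_def A_def using assms by (intro powr_mono2') auto
  have AD: "A \<le> D" unfolding D_def A_def using assms by (intro powr_mono2') auto
  have "A * B = ((2 - x) * (2 - y)) powr (- p)" unfolding A_def B_def using assms by (simp add: powr_mult)
  also have "\<dots> \<le> (2 * (2 - x - y)) powr (- p)" using assms
    by (intro powr_mono2') (auto simp: algebra_simps)
  also have "\<dots> = C * D" unfolding C_def D_def using assms by (simp add: powr_mult[symmetric])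
  finally have AB: "A * B \<le> C * D" .
  \<comment> \<open>Of two pairs, the one with smaller product and containing a number between the
    members of the other has the smaller sum.\<close>
  have "0 \<le> (D - A) * (A - C)" using CA AD by simp
  then have "A * (A + B) \<le> A * (C + D)" using AB by (simp add: algebra_simps)
  then show ?thesis using A0 by (simp add: A_def B_def C_def D_def)
qed

text \<open>The two terms of \<^const>\<open>a_coeff\<close> are the values at the extreme position where \<open>x\<^sub>b + x\<^sub>c\<close> is
  carried by a single coordinate.\<close>

lemma run_exit_le:
  assumes x: "x \<in> cylinder (replicate k a @ b # u)" and ab: "a \<noteq> b" and k: "1 \<le> k"
    and \<delta>: "0 < \<delta>" "\<delta> \<le> 1" "0 < lam"
  shows "(\<Sum>j\<in>UNIV - {a}. (2 - x $ j) powr - (3 * \<delta> + lam * (1 - \<delta>))) \<le> a_coeff lam \<delta> k"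
proof -
  obtain c where c: "c \<noteq> a" "c \<noteq> b" "UNIV - {a} = {b, c}"
  proof -
    have "card {a, b} \<noteq> card (UNIV :: 3 set)" using ab by simp
    then have "UNIV \<noteq> {a, b}" by metis
    then obtain c where "c \<noteq> a" "c \<noteq> b" by blast
    moreover from this have "UNIV - {a} = {b, c}"
      using ab exhaust_3[of a] exhaust_3[of b] exhaust_3[of c] unfolding UNIV_3 by auto
    ultimately show ?thesis using that by blast
  qed
  define p where "p = 3 * \<delta>"
  define r where "r = lam * (1 - \<delta>)"
  define q where "q = (real k + 1) / (2 * real k + 1)"
  have pr: "0 \<le> p" "0 \<le> r" using \<delta> by (auto simp: p_def r_def)
  have xs: "x \<in> simplex3" using x cylinder_subset_simplex3 by blast
  have xbc: "x $ b + x $ c = 1 - x $ a"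
    using xs ab c(1,2) exhaust_3[of a] exhaust_3[of b] exhaust_3[of c] by (auto simp: simplex3_iff)
  have le: "x $ b + x $ c \<le> 1 / (real k + 1)" using run_cylinder_bounds(2)[OF x ab] xbc by simp
  have nn: "0 \<le> x $ b" "0 \<le> x $ c" using simplex3_nth_bounds[OF xs] by auto
  have k1: "1 / (real k + 1) < 2" by (simp add: field_simps)
  have q0: "0 < q" and qi: "1 / q = 2 - 1 / (real k + 1)" by (auto simp: q_def field_simps)
  have pw: "y powr (- e) \<le> q powr e" if "1 / q \<le> y" "0 \<le> e" for y e
  proof -
    have "y powr (- e) \<le> (1 / q) powr (- e)" using that q0 by (intro powr_mono2') auto
    also have "\<dots> = q powr e" using q0 by (simp add: powr_minus powr_divide)
    finally show ?thesis .
  qed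
  have split: "y powr - (p + r) = y powr (- p) * y powr (- r)" for y :: real
    by (simp add: powr_add[symmetric] )
  \<comment> \<open>The exponent is split as \<open>p + r\<close>. The factor with \<open>r\<close>
    is bounded uniformly, and extremality is used only for \<open>p\<close>; this is the shape of
    \<open>a_coeff\<close>.\<close>
  have "(2 - x $ b) powr (- p) * (2 - x $ b) powr (- r) + (2 - x $ c) powr (- p) * (2 - x $ c) powr (- r)
     \<le> (2 - x $ b) powr (- p) * q powr r + (2 - x $ c) powr (- p) * q powr r"
    using nn le pr qi by (intro add_mono mult_left_mono pw) auto
  also have "\<dots> = ((2 - x $ b) powr (- p) + (2 - x $ c) powr (- p)) * q powr r" by (simp add: algebra_simps)
  also have "\<dots> \<le> (2 powr (- p) + (2 - x $ b - x $ c) powr (- p)) * q powr r"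
    using nn le pr k1 by (intro mult_right_mono sum_powr_le_extreme) auto
  also have "\<dots> \<le> (2 powr (- p) + q powr p) * q powr r"
    using le pr qi by (intro mult_right_mono add_left_mono pw) auto
  also have "2 powr (- p) = 1 / 8 powr \<delta>"
  proof -
    have "(2::real) powr p = (2 powr 3) powr \<delta>" unfolding p_def by (simp only: powr_powr)
    then show ?thesis by (simp add: powr_minus field_simps)
  qed
  also have "(1 / 8 powr \<delta> + q powr p) * q powr r = a_coeff lam \<delta> k"
    unfolding a_coeff_def p_def[symmetric] r_def[symmetric] q_def[symmetric]
    by (simp add: powr_add algebra_simps)
  finally show ?thesis using c(2) unfolding c(3) p_def[symmetric] r_def[symmetric] split by simp
qed

lemma run_grow_le:
  assumes x: "x \<in> cylinder (replicate k a @ b # u)" and ab: "a \<noteq> b"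
    and \<delta>: "0 < \<delta>" "\<delta> \<le> 1" "0 < lam"
  shows "(2 - x $ a) powr - (3 * \<delta> + lam * (1 - \<delta>)) \<le> b_coeff lam \<delta> k"
proof -
  define s where "s = 3 * \<delta> + lam * (1 - \<delta>)"
  have s: "0 \<le> s" using \<delta> by (simp add: s_def)
  define q where "q = (real k + 2) / (real k + 3)"
  have q0: "0 < q" and qi: "1 / q = 1 + 1 / (real k + 2)" by (auto simp: q_def field_simps)
  have "(2 - x $ a) powr (- s) \<le> (1 / q) powr (- s)"
    by (intro powr_mono2') (use s in simp, use q0 in simp, use run_cylinder_bounds(1)[OF x ab] qi in simp)
  also have "\<dots> = q powr s" using q0 by (simp add: powr_minus powr_divide)
  finally show ?thesis by (simp add: b_coeff_def s_def q_def)
qed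

lemma cylinder_nonempty: "cylinder w \<noteq> {}"
  using axis_in_simplex3 by (auto simp: cylinder_def)

section \<open>Comparison of weight sums with the matrix for fixed parameters\<close>

context
  fixes m :: nat and lam \<delta> s :: real
  assumes m: "2 \<le> m" and \<delta>: "0 < \<delta>" "\<delta> \<le> 1" and lam: "0 < lam"
    and s: "s = 3 * \<delta> + lam * (1 - \<delta>)"
begin

lemma exponent_nonneg: "0 \<le> s"
  using \<delta> lam by (simp add: s)

lemma bdd_above_matB: "bdd_above ((\<lambda>x. (2 - x $ j) powr (- s)) ` cylinder w)"
proof (rule bdd_aboveI2)
  fix x assume "x \<in> cylinder w"
  then have "x \<in> simplex3" using cylinder_subset_simplex3 by blast
  then have "(2 - x $ j) powr (- s) \<le> 1 powr (- s)"
    using simplex3_nth_bounds[of x j] exponent_nonneg by (intro powr_mono2') auto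
  then show "(2 - x $ j) powr (- s) \<le> 1" by simp
qed

lemma exponent_eq: "- 3 * \<delta> - lam * (1 - \<delta>) = - s"
  by (simp add: s)

lemma matB_nonneg: "0 \<le> matB m lam \<delta> \<alpha> \<beta>"
proof (cases \<beta>)
  case (Word w)
  obtain x where x: "x \<in> cylinder w" using cylinder_nonempty by blast
  show ?thesis unfolding matB_def Word exponent_eq
    by (auto intro!: cSUP_upper2[OF bdd_above_matB x])
qed (simp add: matB_def)

lemma matD_nonneg: "0 \<le> matD m lam \<delta> \<alpha> \<beta>"
  using matB_nonneg by (cases \<alpha>; cases \<beta>) (auto simp: a_coeff_def b_coeff_def)

lemma matD_finite_support: "finite {\<gamma>. matD m lam \<delta> \<gamma> \<alpha> \<noteq> 0}"
proof (rule finite_subset)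
  show "finite (Word ` words m \<union> {Num m} \<union> (case \<alpha> of Num k \<Rightarrow> {Num (k + 1), Word (star m)} | Word v \<Rightarrow> {}))"
    using finite_words by (auto split: index.split)
  show "{\<gamma>. matD m lam \<delta> \<gamma> \<alpha> \<noteq> 0} \<subseteq>
      Word ` words m \<union> {Num m} \<union> (case \<alpha> of Num k \<Rightarrow> {Num (k + 1), Word (star m)} | Word v \<Rightarrow> {})"
  proof
    fix \<gamma> assume "\<gamma> \<in> {\<gamma>. matD m lam \<delta> \<gamma> \<alpha> \<noteq> 0}"
    then show "\<gamma> \<in> Word ` words m \<union> {Num m} \<union> (case \<alpha> of Num k \<Rightarrow> {Num (k + 1), Word (star m)} | Word v \<Rightarrow> {})"
      by (cases \<gamma>; cases \<alpha>) (auto split: if_splits)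
  qed
qed

lemma mat_pow_nonneg: "0 \<le> mat_pow I (matD m lam \<delta>) n \<alpha> \<beta>"
  by (induction n arbitrary: \<beta>) (auto intro!: infsum_nonneg mult_nonneg_nonneg matD_nonneg)

text \<open>A family that is not summable has \<open>infsum\<close> equal to 0, so this lower bound
  needs summability, which comes from the finite support of each column.\<close>

lemma sum_le_mat_pow_Suc:
  assumes "finite F" "F \<subseteq> I"
  shows "(\<Sum>\<gamma>\<in>F. mat_pow I (matD m lam \<delta>) n \<alpha> \<gamma> * matD m lam \<delta> \<gamma> \<beta>) \<le> mat_pow I (matD m lam \<delta>) (Suc n) \<alpha> \<beta>"
proof -
  let ?f = "\<lambda>\<gamma>. mat_pow I (matD m lam \<delta>) n \<alpha> \<gamma> * matD m lam \<delta> \<gamma> \<beta>"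
  let ?S = "{\<gamma>\<in>I. matD m lam \<delta> \<gamma> \<beta> \<noteq> 0}"
  have "finite ?S" by (rule finite_subset[OF _ matD_finite_support]) auto
  then have "?f summable_on ?S" by (rule summable_on_finite)
  then have "?f summable_on I" by (rule summable_on_cong_neutral[THEN iffD1, rotated -1]) auto
  then have "sum ?f F \<le> infsum ?f I"
    using assms by (intro finite_sum_le_infsum) (auto intro!: mult_nonneg_nonneg mat_pow_nonneg matD_nonneg)
  then show ?thesis by simp
qed

text \<open>One letter of the comparison; \<open>g j\<close> is the type after prepending
  \<open>j\<close>. From a \<open>Word\<close> type at most one letter leads to a given type. From a
  run, one letter prolongs it, which gives \<open>b_coeff\<close>, and the other two lead to
  \<open>star m\<close>, which gives \<open>a_coeff\<close>.\<close>

lemma of_type_step: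
  assumes w: "of_type m \<alpha> w" and x: "x \<in> cylinder w"
  shows "\<exists>g. (\<forall>j. of_type m (g j) (j # w)) \<and>
     (\<forall>\<gamma>. (\<Sum>j | g j = \<gamma>. (2 - x $ j) powr (- s)) \<le> matD m lam \<delta> \<gamma> \<alpha>)"
proof (cases \<alpha>)
  case (Word v)
  from w Word obtain \<pi> where v: "v \<in> words m" and \<pi>: "bij \<pi>" "take (m + 1) w = map \<pi> v"
    by (auto simp: of_type_def)
  have w': "w = map \<pi> v @ drop (m + 1) w" unfolding \<pi>(2)[symmetric] by (rule append_take_drop_id[symmetric])
  obtain h where h: "\<And>j. adj m j (Word v) (h j)" using ex_adj[OF v] by metis
  \<comment> \<open>A letter \<open>j\<close> in front of \<open>w\<close> corresponds to the letter
    \<open>inv \<pi> j\<close> in front of the normalised word \<open>v\<close>.\<close>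
  define g where "g = (\<lambda>j. h (inv \<pi> j))"
  have \<pi>i: "\<pi> (inv \<pi> j) = j" for j using \<pi>(1) by (simp add: bij_def surj_f_inv_f)
  have ty: "of_type m (g j) (j # w)" for j
  proof -
    have "of_type m (g j) (inv \<pi> j # v)" unfolding g_def by (rule adj_of_type[OF h])
    then have "of_type m (g j) (map \<pi> (inv \<pi> j # v) @ drop (m + 1) w)"
      by (intro of_type_append of_type_map \<pi>)
    moreover have "map \<pi> (inv \<pi> j # v) @ drop (m + 1) w = j # (map \<pi> v @ drop (m + 1) w)"
      by (simp add: \<pi>i)
    ultimately show ?thesis unfolding w'[symmetric] by simp
  qed
  have uniq: "i = j" if "adj m i (Word v) \<gamma>" "adj m j (Word v) \<gamma>" for i j \<gamma>
    using of_type_Cons_unique[OF m v adj_of_type[OF that(1)] adj_of_type[OF that(2)]] .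
  have "(\<Sum>j | g j = \<gamma>. (2 - x $ j) powr (- s)) \<le> matD m lam \<delta> \<gamma> \<alpha>" for \<gamma>
  proof (cases "\<exists>j. g j = \<gamma>")
    case True
    then obtain j where j: "g j = \<gamma>" by blast
    have "i = j" if "g i = \<gamma>" for i
    proof -
      have "inv \<pi> i = inv \<pi> j" using uniq[OF h[of "inv \<pi> i"], of "inv \<pi> j"] h[of "inv \<pi> j"] that j
        by (simp add: g_def)
      then show ?thesis using \<pi>i by metis
    qed
    then have S: "{i. g i = \<gamma>} = {j}" using j by blast
    have a: "adj m (inv \<pi> j) (Word v) \<gamma>" using h j by (auto simp: g_def)
    then have THE: "(THE i. adj m i (Word v) \<gamma>) = inv \<pi> j" using uniq by blast
    have ex: "\<exists>i. adj m i (Word v) \<gamma>" using a by blast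
    have xv: "x \<in> cylinder (map \<pi> v)" 
      using x cylinder_append_subset[of "map \<pi> v" "drop (m + 1) w"] unfolding w'[symmetric] by blast
    have "(2 - x $ j) powr (- s) = (2 - pcoord \<pi> x $ inv \<pi> j) powr (- s)"
      by (simp add: pcoord_def \<pi>i)
    also have "\<dots> \<le> matB m lam \<delta> \<gamma> (Word v)"
      unfolding matB_def exponent_eq index.case if_P[OF ex] THE
      by (rule cSUP_upper[OF pcoord_cylinder[OF \<pi>(1) xv] bdd_above_matB])
    also have "\<dots> = matD m lam \<delta> \<gamma> \<alpha>"
    proof (cases \<gamma>)
      case (Word v')
      then have "v' \<in> words m" using ty[of j] j by (simp add: of_type_def)
      then show ?thesis using v Word \<open>\<alpha> = Word v\<close> by simp
    next
      case (Num l)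
      then have "l = m" using a by (auto elim: adj.cases)
      then show ?thesis using v Num \<open>\<alpha> = Word v\<close> by simp
    qed
    finally show ?thesis by (simp add: S)
  qed (use matD_nonneg in auto)
  then show ?thesis using ty by blast
next
  case (Num k)
  from w Num obtain a b u where k: "m \<le> k" and ab: "a \<noteq> b" and w': "w = replicate k a @ b # u"
    by (auto simp: of_type_def)
  define g where "g = (\<lambda>j. if j = a then Num (k + 1) else Word (star m))"
  have ty: "of_type m (g j) (j # w)" for j
  proof (cases "j = a")
    case True
    have "a # w = replicate (k + 1) a @ b # u" using w' by simp
    then show ?thesis using True k ab unfolding of_type_def g_def by auto
  next
    case False
    \<comment> \<open>As \<open>m \<le> k\<close>, the new word starts with \<open>j\<close> and
      \<open>m\<close> copies of \<open>a\<close>, a renaming of \<open>star m\<close>.\<close>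
    obtain \<pi> :: "3 \<Rightarrow> 3" where \<pi>: "bij \<pi>" "\<pi> 1 = j" "\<pi> 2 = a" using False by (rule ex_bij3)
    have "take (m + 1) (j # w) = map \<pi> (star m)" using k \<pi> w' by (simp add: star_def min_def)
    then show ?thesis using False \<pi> star_mem_words[OF m] by (auto simp: of_type_def g_def)
  qed
  have x': "x \<in> cylinder (replicate k a @ b # u)" using x w' by simp
  have "(\<Sum>j | g j = \<gamma>. (2 - x $ j) powr (- s)) \<le> matD m lam \<delta> \<gamma> \<alpha>" for \<gamma>
  proof -
    consider "\<gamma> = Num (k + 1)" | "\<gamma> = Word (star m)" | "\<gamma> \<noteq> Num (k + 1)" "\<gamma> \<noteq> Word (star m)" by blast
    then show ?thesis
    proof cases
      case 1
      then have "{j. g j = \<gamma>} = {a}" by (auto simp: g_def)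
      then show ?thesis using run_grow_le[OF x' ab \<delta> lam] 1 Num k by (simp add: s)
    next
      case 2
      then have "{j. g j = \<gamma>} = UNIV - {a}" by (auto simp: g_def)
      then show ?thesis using run_exit_le[OF x' ab _ \<delta> lam] 2 Num k m by (simp add: s)
    next
      case 3
      then have "{j. g j = \<gamma>} = {}" by (auto simp: g_def)
      then show ?thesis using matD_nonneg by simp
    qed
  qed
  then show ?thesis using ty by blast
qed

text \<open>Induction on the letter adjacent to \<open>w\<close>: it is absorbed into the base word
  and moves the point to \<open>T j x\<close>, in step with the recursion of \<open>mat_pow\<close>
  on its right factor. For \<open>n = 0\<close>, uniqueness of types gives the identity
  matrix.\<close>

lemma sum_wt_le_mat_pow:
  assumes "of_type m \<alpha> w" "x \<in> cylinder w"
  shows "(\<Sum>i | length i = n \<and> of_type m \<beta> (i @ w). wt i x powr (- s))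
     \<le> mat_pow (indices m) (matD m lam \<delta>) n \<beta> \<alpha>"
  using assms
proof (induction n arbitrary: \<alpha> w x)
  case 0
  then show ?case using of_type_unique[OF m] by (auto simp: conj_commute cong: conj_cong)
next
  case (Suc n)
  obtain g where g: "\<And>j. of_type m (g j) (j # w)"
    "\<And>\<gamma>. (\<Sum>j | g j = \<gamma>. (2 - x $ j) powr (- s)) \<le> matD m lam \<delta> \<gamma> \<alpha>"
    using of_type_step[OF Suc.prems] by blast
  let ?D = "mat_pow (indices m) (matD m lam \<delta>) n \<beta>"
  have xs: "x \<in> simplex3" using Suc.prems(2) cylinder_subset_simplex3 by blast
  have fin: "finite {i :: 3 list. length i = n \<and> P i}" for P
    by (rule finite_subset[OF _ finite_lists_length_eq[of UNIV n]]) auto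
  have bl: "butlast i @ [last i] = i" if "length i = Suc n" for i :: "3 list"
    using that by (intro append_butlast_last_id) auto
  have "(\<Sum>i | length i = Suc n \<and> of_type m \<beta> (i @ w). wt i x powr (- s))
     = (\<Sum>(j, i)\<in>Sigma UNIV (\<lambda>j. {i. length i = n \<and> of_type m \<beta> (i @ (j # w))}). wt (i @ [j]) x powr (- s))"
  proof (rule sum.reindex_bij_witness[of _ "\<lambda>(j, i). i @ [j]" "\<lambda>i. (last i, butlast i)"])
    fix i assume "i \<in> {i. length i = Suc n \<and> of_type m \<beta> (i @ w)}"
    then have i: "i \<noteq> []" "length i = Suc n" "of_type m \<beta> (i @ w)" by auto
    have "butlast i @ last i # w = i @ w" using append_butlast_last_id[OF i(1)] by (metis append.assoc append_Cons append_Nil)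
    then have "of_type m \<beta> (butlast i @ last i # w)" using i(3) by (simp only:)
    with i(2) show "(last i, butlast i) \<in> Sigma UNIV (\<lambda>j. {i. length i = n \<and> of_type m \<beta> (i @ (j # w))})"
      by simp
  qed (auto simp: bl)
  also have "\<dots> = (\<Sum>j\<in>UNIV. \<Sum>i | length i = n \<and> of_type m \<beta> (i @ (j # w)). wt (i @ [j]) x powr (- s))"
    by (rule sum.Sigma[symmetric]) (auto intro: fin)
  also have "\<dots> = (\<Sum>j\<in>UNIV. (2 - x $ j) powr (- s) *
      (\<Sum>i | length i = n \<and> of_type m \<beta> (i @ (j # w)). wt i (T j x) powr (- s)))"
  proof (intro sum.cong refl)
    fix j
    have "0 \<le> 2 - x $ j" using simplex3_nth_bounds[OF xs, of j] by simp
    then show "(\<Sum>i | length i = n \<and> of_type m \<beta> (i @ (j # w)). wt (i @ [j]) x powr (- s))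
      = (2 - x $ j) powr (- s) * (\<Sum>i | length i = n \<and> of_type m \<beta> (i @ (j # w)). wt i (T j x) powr (- s))"
      using wt_pos[OF T_in_simplex3[OF xs]]
      by (auto simp: sum_distrib_left wt_append powr_mult less_imp_le intro!: sum.cong)
  qed
  also have "\<dots> \<le> (\<Sum>j\<in>UNIV. (2 - x $ j) powr (- s) * ?D (g j))"
    using Suc.prems(2) by (intro sum_mono mult_left_mono Suc.IH g(1)) (auto simp: cylinder_Cons)
  \<comment> \<open>Letters leading to the same type are grouped, since a matrix entry bounds only
    their joint contribution.\<close>
  also have "\<dots> = (\<Sum>\<gamma>\<in>range g. \<Sum>j | g j = \<gamma>. (2 - x $ j) powr (- s) * ?D (g j))"
    using sum.image_gen[of UNIV "\<lambda>j. (2 - x $ j) powr (- s) * ?D (g j)" g] by simp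
  also have "\<dots> = (\<Sum>\<gamma>\<in>range g. ?D \<gamma> * (\<Sum>j | g j = \<gamma>. (2 - x $ j) powr (- s)))"
    by (auto simp: sum_distrib_left mult.commute intro!: sum.cong)
  also have "\<dots> \<le> (\<Sum>\<gamma>\<in>range g. ?D \<gamma> * matD m lam \<delta> \<gamma> \<alpha>)"
    by (intro sum_mono mult_left_mono g(2) mat_pow_nonneg)
  also have "\<dots> \<le> mat_pow (indices m) (matD m lam \<delta>) (Suc n) \<beta> \<alpha>"
    using g(1) of_type_indices by (intro sum_le_mat_pow_Suc) auto
  finally show ?case .
qed

text \<open>Prepending \<open>star m\<close> forces the type \<open>*\<close> on every word, so all
  words of length \<open>n\<close> embed into returns from \<open>*\<close> to \<open>*\<close> of
  length \<open>n + m + 1\<close>. The \<open>m + 1\<close> extra letters multiply \<open>wt\<close>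
  by at most \<open>2 ^ (m + 1)\<close>.\<close>

lemma sum_wt_le_return:
  assumes "z \<in> cylinder (star m)"
  shows "(\<Sum>i | length i = n. wt i z powr (- s))
     \<le> 2 powr (real (m + 1) * s) * mat_pow (indices m) (matD m lam \<delta>) (Suc (n + m)) (Word (star m)) (Word (star m))"
proof -
  have zs: "z \<in> simplex3" using assms cylinder_subset_simplex3 by blast
  have len: "length (star m) = m + 1" by (simp add: star_def)
  have star: "of_type m (Word (star m)) (star m @ y)" for y
    using star_mem_words[OF m] by (auto simp: of_type_def star_def intro!: exI[of _ id])
  have fin: "finite {i :: 3 list. length i = n \<and> P i}" for n P
    by (rule finite_subset[OF _ finite_lists_length_eq[of UNIV n]]) auto
  have "wt i z powr (- s) \<le> 2 powr (real (m + 1) * s) * wt (star m @ i) z powr (- s)" for i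
  proof -
    have fs: "foldr T i z \<in> simplex3" by (rule foldr_T_in_simplex3[OF zs])
    have pw: "2 powr (real (m + 1) * s) = ((2::real) ^ (m + 1)) powr s"
      by (simp only: powr_powr[symmetric] powr_realpow zero_less_numeral)
    have le: "wt (star m) (foldr T i z) \<le> 2 ^ (m + 1)" using wt_bounds(2)[OF fs, of "star m"] len by simp
    have eq: "2 powr (real (m + 1) * s) * wt (star m @ i) z powr (- s)
       = wt i z powr (- s) * ((2 ^ (m + 1)) powr s * wt (star m) (foldr T i z) powr (- s))"
      using wt_pos[OF zs, of i] wt_pos[OF fs, of "star m"]
      unfolding pw by (simp add: wt_append powr_mult less_imp_le)
    have "1 \<le> (2 ^ (m + 1)) powr s * wt (star m) (foldr T i z) powr (- s)"
      using le wt_pos[OF fs, of "star m"] exponent_nonneg powr_mono2[OF exponent_nonneg _ le]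
      by (simp add: powr_minus field_simps)
    then show ?thesis unfolding eq using mult_left_mono[of 1 _ "wt i z powr (- s)"] by simp
  qed
  then have "(\<Sum>i | length i = n. wt i z powr (- s))
      \<le> (\<Sum>i | length i = n. 2 powr (real (m + 1) * s) * wt (star m @ i) z powr (- s))"
    by (intro sum_mono)
  also have "\<dots> = 2 powr (real (m + 1) * s) * (\<Sum>i\<in>(@) (star m) ` {i. length i = n}. wt i z powr (- s))"
    by (subst sum.reindex) (auto simp: sum_distrib_left inj_on_def)
  also have "\<dots> \<le> 2 powr (real (m + 1) * s) *
      (\<Sum>i | length i = Suc (n + m) \<and> of_type m (Word (star m)) (i @ star m). wt i z powr (- s))"
    by (intro mult_left_mono sum_mono2 fin) (auto simp: star len)
  also have "\<dots> \<le> 2 powr (real (m + 1) * s) *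
      mat_pow (indices m) (matD m lam \<delta>) (Suc (n + m)) (Word (star m)) (Word (star m))"
    using star[of "[]"] assms by (intro mult_left_mono sum_wt_le_mat_pow) auto
  finally show ?thesis .
qed

end

section \<open>The gasket\<close>

lemma dist_simplex3_axis:
  assumes "x \<in> simplex3" shows "dist x (axis j 1) \<le> 2 * (1 - x $ j)"
proof -
  have "dist x (axis j 1) \<le> (\<Sum>i\<in>UNIV. \<bar>(x - axis j 1) $ i\<bar>)" unfolding dist_norm by (rule norm_le_l1_cart)
  also have "\<dots> = 2 * (1 - x $ j)"
    using assms exhaust_3[of j] by (auto simp: sum_3 axis_def simplex3_iff)
  finally show ?thesis .
qed

lemma dist_simplex3_le:
  assumes "x \<in> simplex3" "y \<in> simplex3" shows "dist x y \<le> 2"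
proof -
  have "dist x y \<le> (\<Sum>i\<in>UNIV. \<bar>(x - y) $ i\<bar>)" unfolding dist_norm by (rule norm_le_l1_cart)
  also have "\<dots> \<le> (\<Sum>i\<in>UNIV. x $ i + y $ i)"
    using simplex3_nth_bounds(1)[OF assms(1)] simplex3_nth_bounds(1)[OF assms(2)]
    by (intro sum_mono) (simp add: abs_le_iff add_increasing add_increasing2)
  also have "\<dots> = 2" using assms by (simp add: sum.distrib simplex3_def)
  finally show ?thesis .
qed

lemma replicate_T_near_vertex:
  assumes "z \<in> simplex3" shows "1 - foldr T (replicate k a) z $ a \<le> 1 / (real k + 1)"
proof -
  define t where "t = 1 - z $ a"
  have t: "0 \<le> t" "t \<le> 1" using simplex3_nth_bounds[OF assms, of a] by (auto simp: t_def)
  have p: "0 < 1 + real k * t" using t by (auto intro!: add_pos_nonneg)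
  show ?thesis unfolding foldr_T_replicate_nth[OF assms] t_def[symmetric] using p t by (simp add: field_simps)
qed

section \<open>Topology of the simplex and existence of the gasket\<close>

lemma closed_simplex3: "closed simplex3"
proof -
  have "closed (convex hull {axis 1 1, axis 2 1, axis 3 1 :: real^3})"
    by (intro compact_imp_closed finite_imp_compact_convex_hull) simp
  then show ?thesis by (simp add: simplex3_eq_hull)
qed

lemma compact_simplex3: "compact simplex3"
  unfolding simplex3_eq_hull by (intro finite_imp_compact_convex_hull) simp

lemma continuous_on_T: "continuous_on simplex3 (T j)"
proof (rule lipschitz_on_continuous_on[of 1], rule lipschitz_onI)
  define lam :: real where "lam = 3 / 2 - 1 / sqrt 3"
  note l = contraction_exponent_bounds[OF lam_def]
  fix p q assume pq: "p \<in> simplex3" "q \<in> simplex3"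
  have "(2 - p $ j) powr (- lam) \<le> 1 powr (- lam)"
    using simplex3_nth_bounds[OF pq(1), of j] l by (intro powr_mono2') auto
  then have "dist p q * (2 - p $ j) powr (- lam) \<le> dist p q * 1" by (intro mult_left_mono) auto
  then show "dist (T j p) (T j q) \<le> 1 * dist p q" using dist_T_le[OF pq lam_def, of j] by simp
qed simp

text \<open>The gasket is the closure of the orbit of a vertex: every nonempty closed invariant set
  contains the vertex, as it is the limit of the iterates of a single \<^const>\<open>T\<close>.\<close>

lemma rauzy_gasket_subset: "rauzy_gasket \<subseteq> simplex3"
  and rauzy_gasket_invariant: "rauzy_gasket = (\<Union>j\<in>UNIV. T j ` rauzy_gasket)"
proof -
  let ?O = "range (\<lambda>i. foldr T i (axis 1 1))"
  let ?P = "\<lambda>G. G \<noteq> {} \<and> closed G \<and> G \<subseteq> simplex3 \<and> G = (\<Union>j\<in>UNIV. T j ` G)"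
  have O: "?O \<subseteq> simplex3" by (auto intro: foldr_T_in_simplex3 axis_in_simplex3)
  then have K: "closure ?O \<subseteq> simplex3" using closed_simplex3 by (rule closure_minimal)
  have OU: "?O = (\<Union>j\<in>UNIV. T j ` ?O)"
  proof (intro equalityI subsetI)
    fix x assume "x \<in> ?O"
    then obtain i where i: "x = foldr T i (axis 1 1)" by blast
    show "x \<in> (\<Union>j\<in>UNIV. T j ` ?O)"
    proof (cases i)
      case Nil
      \<comment> \<open>The vertex is fixed by \<open>T 1\<close>, so even the orbit point of the
        empty word is an image.\<close>
      have "T 1 (axis 1 1) = axis 1 (1::real)" by (auto simp: vec_eq_iff T_nth axis_def)
      then have "x = T 1 (foldr T [] (axis 1 1))" using i Nil by simp
      then show ?thesis by blast
    next
      case (Cons j i')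
      then show ?thesis using i by auto
    qed
  next
    fix x assume "x \<in> (\<Union>j\<in>UNIV. T j ` ?O)"
    then obtain j i where "x = foldr T (j # i) (axis 1 1)" by auto
    then show "x \<in> ?O" by blast
  qed
  \<comment> \<open>Continuous maps on compact sets commute with closure, which transfers invariance
    from the orbit to its closure.\<close>
  have TK: "T j ` closure ?O = closure (T j ` ?O)" for j
  proof (rule equalityI)
    have c: "continuous_on (closure ?O) (T j)" using continuous_on_T K by (rule continuous_on_subset)
    show "T j ` closure ?O \<subseteq> closure (T j ` ?O)"
      by (rule image_closure_subset[OF c]) (auto intro: closure_subset[THEN subsetD])
    have "compact (closure ?O)" using K compact_simplex3 by (metis closed_closure compact_Int_closed inf.absorb_iff2)
    then have "closed (T j ` closure ?O)" using c by (intro compact_imp_closed compact_continuous_image)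
    then show "closure (T j ` ?O) \<subseteq> T j ` closure ?O"
      by (intro closure_minimal image_mono closure_subset)
  qed
  have "closure ?O = closure (\<Union>j\<in>UNIV. T j ` ?O)" using OU by simp
  also have "\<dots> = (\<Union>j\<in>UNIV. closure (T j ` ?O))" by (simp add: UNIV_3 closure_Un)
  finally have "closure ?O = (\<Union>j\<in>UNIV. closure (T j ` ?O))" .
  then have KU: "closure ?O = (\<Union>j\<in>UNIV. T j ` closure ?O)" unfolding TK .
  have PK: "?P (closure ?O)" using K KU by (auto simp: closure_eq_empty)
  have min: "closure ?O \<subseteq> G" if G: "?P G" for G
  proof (rule closure_minimal)
    from G obtain x where x: "x \<in> G" by blast
    have TG: "foldr T i y \<in> G" if "y \<in> G" for i y using that G by (induction i) auto
    have "(\<lambda>k. foldr T (replicate k 1) x) \<longlonglongrightarrow> axis 1 1"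
    proof (rule LIMSEQ_I)
      fix r :: real assume r: "0 < r"
      obtain N :: nat where N: "2 / r < real N" using reals_Archimedean2 by blast
      show "\<exists>no. \<forall>n\<ge>no. norm (foldr T (replicate n 1) x - axis 1 1) < r"
      proof (intro exI[of _ N] allI impI)
        fix n assume n: "N \<le> n"
        have xs: "x \<in> simplex3" using x G by blast
        have "norm (foldr T (replicate n 1) x - axis 1 1) \<le> 2 * (1 / (real n + 1))"
          using dist_simplex3_axis[OF foldr_T_in_simplex3[OF xs, of "replicate n 1"], of 1]
            replicate_T_near_vertex[OF xs, of n 1] by (simp add: dist_norm)
        also have "\<dots> < r" 
        proof -
          have "2 / r < real n + 1" using n N by linarith
          then show ?thesis using r by (simp add: field_simps)
        qed
        finally show "norm (foldr T (replicate n 1) x - axis 1 1) < r" .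
      qed
    qed
    then have "axis 1 1 \<in> G" 
      by (rule closed_sequentially[rotated 2]) (use G in blast, rule TG[OF x])
    then show "?O \<subseteq> G" using TG by blast
    show "closed G" using G by blast
  qed
  have eq: "rauzy_gasket = closure ?O" unfolding rauzy_gasket_def
    by (rule Least_equality) (use PK min in blast)+
  show "rauzy_gasket \<subseteq> simplex3" "rauzy_gasket = (\<Union>j\<in>UNIV. T j ` rauzy_gasket)"
    using PK unfolding eq by blast+
qed

text \<open>If the coding of \<open>y\<close> changes letter somewhere, then \<open>y\<close> lies
  in such a cylinder. Otherwise the coding repeats one letter \<open>j\<close> forever, and then
  \<open>y\<close> is vertex \<open>j\<close>.\<close>

lemma rauzy_gasket_cases:
  assumes y: "y \<in> rauzy_gasket"
  shows "(\<exists>j. y = axis j 1) \<or> (\<exists>i a b. a \<noteq> b \<and> y \<in> cylinder (i @ [a, b]))"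
proof (rule ccontr)
  assume "\<not> ?thesis"
  then have ne: "\<And>j. y \<noteq> axis j 1" and nc: "\<And>i a b. a \<noteq> b \<Longrightarrow> y \<notin> cylinder (i @ [a, b])" by auto
  obtain j y1 where j: "y = T j y1" "y1 \<in> rauzy_gasket" using y rauzy_gasket_invariant by blast
  have all: "\<exists>z\<in>rauzy_gasket. y = foldr T (replicate (Suc k) j) z" for k
  proof (induction k)
    case 0 then show ?case using j by auto
  next
    case (Suc k)
    then obtain z where z: "z \<in> rauzy_gasket" "y = foldr T (replicate (Suc k) j) z" by blast
    then obtain b z' where b: "z = T b z'" "z' \<in> rauzy_gasket" using rauzy_gasket_invariant by blast
    have "b = j"
    proof (rule ccontr)
      assume "b \<noteq> j"
      have "y = foldr T (replicate k j @ [j, b]) z'"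
        using z(2) b(1) by (simp add: replicate_app_Cons_same)
      then have "y \<in> cylinder (replicate k j @ [j, b])"
        using b(2) rauzy_gasket_subset unfolding cylinder_def by blast
      then show False using nc \<open>b \<noteq> j\<close> by metis
    qed
    then have "y = foldr T (replicate (Suc (Suc k)) j) z'" using z(2) b(1)
      by (simp add: foldr_replicate funpow_swap1)
    then show ?case using b(2) by blast
  qed
  have ys: "y \<in> simplex3" using y rauzy_gasket_subset by blast
  have "dist y (axis j 1) \<le> 0"
  proof (rule LIMSEQ_le_const)
    show "(\<lambda>k. 2 * inverse (real (Suc (Suc k)))) \<longlonglongrightarrow> 0"
      using tendsto_mult_right_zero[OF LIMSEQ_Suc[OF LIMSEQ_inverse_real_of_nat], of 2] by simp
    show "\<exists>N. \<forall>k\<ge>N. dist y (axis j 1) \<le> 2 * inverse (real (Suc (Suc k)))"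
    proof (intro exI allI impI)
      fix k
      obtain z where z: "z \<in> rauzy_gasket" "y = foldr T (replicate (Suc k) j) z" using all by blast
      have "1 - y $ j \<le> 1 / (real (Suc k) + 1)"
        using replicate_T_near_vertex[of z "Suc k" j] z rauzy_gasket_subset by auto
      then show "dist y (axis j 1) \<le> 2 * inverse (real (Suc (Suc k)))"
        using dist_simplex3_axis[OF ys, of j] by (simp add: inverse_eq_divide)
    qed
  qed
  then show False using ne by simp
qed

lemma rauzy_gasket_iterate: "rauzy_gasket \<subseteq> (\<Union>i\<in>{i. length i = N}. foldr T i ` rauzy_gasket)"
proof (induction N)
  case (Suc N)
  show ?case
  proof
    fix x assume "x \<in> rauzy_gasket"
    then obtain j y where y: "x = T j y" "y \<in> rauzy_gasket" using rauzy_gasket_invariant by blast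
    then obtain i z where "length i = N" "z \<in> rauzy_gasket" "y = foldr T i z" using Suc by blast
    then have "x = foldr T (j # i) z" "length (j # i) = Suc N" "z \<in> rauzy_gasket" using y by auto
    then show "x \<in> (\<Union>i\<in>{i. length i = Suc N}. foldr T i ` rauzy_gasket)" by blast
  qed
qed simp

text \<open>The dichotomy is applied after \<open>N\<close> letters, so that all cylinders used have
  long words and the exceptional points are the finitely many images of vertices.\<close>

lemma rauzy_gasket_cover:
  "rauzy_gasket \<subseteq> (\<lambda>(i, j). foldr T i (axis j 1)) ` ({i. length i = N} \<times> UNIV)
     \<union> (\<Union>n. \<Union>(i, a, b)\<in>{i. length i = n + N} \<times> {(a, b). a \<noteq> b}. cylinder (i @ [a, b]))"
proof
  fix x assume "x \<in> rauzy_gasket"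
  then obtain i y where i: "length i = N" "y \<in> rauzy_gasket" "x = foldr T i y"
    using rauzy_gasket_iterate by blast
  from rauzy_gasket_cases[OF i(2)]
  consider j where "y = axis j 1" | i' a b where "a \<noteq> b" "y \<in> cylinder (i' @ [a, b])" by blast
  then show "x \<in> (\<lambda>(i, j). foldr T i (axis j 1)) ` ({i. length i = N} \<times> UNIV)
     \<union> (\<Union>n. \<Union>(i, a, b)\<in>{i. length i = n + N} \<times> {(a, b). a \<noteq> b}. cylinder (i @ [a, b]))"
  proof cases
    case 1
    then show ?thesis using i by force
  next
    case 2
    have "x \<in> cylinder ((i @ i') @ [a, b])"
      unfolding append_assoc cylinder_append[of i] i(3) using 2(2) by (rule imageI)
    moreover have "length (i @ i') = length i' + N" using i by simp
    ultimately have "x \<in> (\<Union>(i, a, b)\<in>{i. length i = length i' + N} \<times> {(a, b). a \<noteq> b}. cylinder (i @ [a, b]))"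
      using 2(1) by (intro UN_I[of "(i @ i', a, b)"]) auto
    then show ?thesis by (intro UnI2 UN_I[of "length i'"]) auto
  qed
qed

text \<open>The vertices are reordered to put the longest side first; this changes the determinant
  at most in sign.\<close>

lemma hausdorff_content_triangle_simplex3:
  assumes \<delta>: "0 < \<delta>" "\<delta> \<le> 1" and s: "p \<in> simplex3" "q \<in> simplex3" "r \<in> simplex3"
    and L: "dist p q \<le> L" "dist p r \<le> L" "dist q r \<le> L" "0 < L"
    and E: "sqrt 3 * \<bar>det3 p q r\<bar> \<le> E" "0 < E" and e: "2 * L \<le> e"
  shows "hausdorff_content (1 + \<delta>) e (convex hull {p, q, r}) \<le> ennreal (12 * L powr (1 - \<delta>) * E powr \<delta>)"
proof -
  have *: ?thesis if "{p', q', r'} = {p, q, r}" "dist p' r' \<le> dist p' q'" "dist q' r' \<le> dist p' q'"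
    "dist p' q' \<le> L" "\<bar>det3 p' q' r'\<bar> = \<bar>det3 p q r\<bar>" for p' q' r'
  proof -
    have "p' \<in> simplex3" "q' \<in> simplex3" "r' \<in> simplex3" using that(1) s by auto
    then have "norm (cross3 (q' - p') (r' - p')) \<le> E" using norm_cross_simplex3 that(5) E(1) by simp
    from hausdorff_content_triangle[OF \<delta> that(2-4) L(4) this E(2) e] that(1) show ?thesis by simp
  qed
  consider "dist p r \<le> dist p q \<and> dist q r \<le> dist p q" | "dist p q \<le> dist p r \<and> dist r q \<le> dist p r"
    | "dist q p \<le> dist q r \<and> dist r p \<le> dist q r" 
    using dist_commute[of r q] dist_commute[of q p] dist_commute[of r p] by linarith
  then show ?thesis
  proof cases
    case 1 then show ?thesis using L by (intro *[of p q r]) auto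
  next
    case 2
    have "det3 p r q = - det3 p q r" by (simp add: det3_def algebra_simps)
    with 2 show ?thesis using L by (intro *[of p r q]) auto
  next
    case 3 
    have "det3 q r p = det3 p q r" by (simp add: det3_def algebra_simps)
    with 3 show ?thesis using L by (intro *[of q r p]) auto
  qed
qed

text \<open>By bounded distortion \<open>wt i\<close> is at least \<open>W\<close> at the three
  vertices before \<open>T\<close> is applied along \<open>i\<close>. Hence the sides are of order
  \<open>W powr (- lam)\<close> and the area of order \<open>W powr (- 3)\<close>; the triangle
  bound combines these to the exponent \<open>s\<close>.\<close>

lemma hausdorff_content_cylinder:
  assumes lam: "lam = 3 / 2 - 1 / sqrt 3" and \<delta>: "0 < \<delta>" "\<delta> \<le> 1" and ab: "a \<noteq> b" and z: "z \<in> simplex3"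
    and e: "4 * (wt i z / 4) powr (- lam) \<le> e" and s: "s = 3 * \<delta> + lam * (1 - \<delta>)"
  shows "hausdorff_content (1 + \<delta>) e (cylinder (i @ [a, b])) \<le> ennreal (24 * 4 powr s * wt i z powr (- s))"
proof -
  define W where "W = wt i z / 4"
  have W: "0 < W" using wt_pos[OF z, of i] by (simp add: W_def)
  note l = contraction_exponent_bounds[OF lam]
  define P where "P = (\<lambda>k. T a (T b (axis k 1)))"
  have Pc: "P k \<in> cylinder [a, b]" for k
    using axis_in_simplex3 by (auto simp: P_def cylinder_def)
  have Ps: "P k \<in> simplex3" for k using Pc cylinder_subset_simplex3 by blast
  have wP: "W \<le> wt i (P k)" for k unfolding W_def by (rule wt_distortion[OF Pc ab z])
  have hull: "cylinder (i @ [a, b]) \<subseteq> convex hull {foldr T i (P 1), foldr T i (P 2), foldr T i (P 3)}"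
    using cylinder_subset_hull[of "i @ [a, b]"] by (simp add: P_def)
  \<comment> \<open>The 2 in \<open>L\<close> bounds distances in the simplex, the 2 in
    \<open>E\<close> bounds \<open>sqrt 3\<close>; together they turn 12 into 24.\<close>
  define L where "L = 2 * W powr (- lam)"
  define E where "E = 2 * W powr (- 3)"
  have dist: "dist (foldr T i (P k)) (foldr T i (P l)) \<le> L" for k l
  proof -
    have "dist (foldr T i (P k)) (foldr T i (P l)) \<le> dist (P k) (P l) * wt i (P k) powr (- lam)"
      by (rule dist_foldr_T_le[OF lam Ps Ps])
    also have "\<dots> \<le> 2 * W powr (- lam)"
      using dist_simplex3_le[OF Ps Ps] wP W l by (intro mult_mono powr_mono2') auto
    finally show ?thesis by (simp add: L_def)
  qed
  have "\<bar>det3 (foldr T i (P 1)) (foldr T i (P 2)) (foldr T i (P 3))\<bar> * W ^ 3 \<le> 1"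
  proof -
    have "W ^ 3 \<le> wt i (P 1) * wt i (P 2) * wt i (P 3)"
      unfolding power3_eq_cube using wP W wt_pos[OF Ps] by (intro mult_mono) (auto intro: less_imp_le mult_nonneg_nonneg)
    then have "\<bar>det3 (foldr T i (P 1)) (foldr T i (P 2)) (foldr T i (P 3))\<bar> * W ^ 3
      \<le> \<bar>det3 (foldr T i (P 1)) (foldr T i (P 2)) (foldr T i (P 3))\<bar> * \<bar>wt i (P 1) * wt i (P 2) * wt i (P 3)\<bar>"
      by (intro mult_left_mono) auto
    also have "\<dots> = \<bar>det3 (P 1) (P 2) (P 3)\<bar>"
      unfolding abs_mult[symmetric] by (simp only: det3_foldr_T[OF Ps Ps Ps])
    also have "\<dots> \<le> 1" by (rule det3_simplex3_le[OF Ps Ps Ps])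
    finally show ?thesis .
  qed
  then have "\<bar>det3 (foldr T i (P 1)) (foldr T i (P 2)) (foldr T i (P 3))\<bar> \<le> W powr (- 3)"
    using W by (simp add: powr_minus powr_numeral field_simps)
  moreover have "sqrt 3 \<le> 2" by (rule real_le_lsqrt) auto
  ultimately have "sqrt 3 * \<bar>det3 (foldr T i (P 1)) (foldr T i (P 2)) (foldr T i (P 3))\<bar> \<le> E"
    unfolding E_def by (intro mult_mono) auto
  then have "hausdorff_content (1 + \<delta>) e (convex hull {foldr T i (P 1), foldr T i (P 2), foldr T i (P 3)})
      \<le> ennreal (12 * L powr (1 - \<delta>) * E powr \<delta>)"
    using e W by (intro hausdorff_content_triangle_simplex3 \<delta> dist foldr_T_in_simplex3 Ps)
      (auto simp: L_def E_def W_def)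
  also have "12 * L powr (1 - \<delta>) * E powr \<delta> = 24 * W powr (- s)"
  proof -
    have "L powr (1 - \<delta>) * E powr \<delta> = (2 powr (1 - \<delta>) * 2 powr \<delta>) * (W powr (- lam * (1 - \<delta>)) * W powr (- 3 * \<delta>))"
      using W by (simp add: L_def E_def powr_mult powr_powr)
    also have "\<dots> = 2 * W powr (- s)"
      unfolding powr_add[symmetric] by (simp add: s algebra_simps)
    finally show ?thesis by (simp add: mult.assoc)
  qed
  also have "W powr (- s) = 4 powr s * wt i z powr (- s)"
    using wt_pos[OF z, of i] by (simp add: W_def powr_divide powr_minus field_simps)
  finally show ?thesis using hausdorff_content_mono[OF hull, of "1 + \<delta>" e] by (auto simp: mult.assoc)
qed

lemma hausdorff_content_rauzy_gasket:
  assumes lam: "lam = 3 / 2 - 1 / sqrt 3" and \<delta>: "0 < \<delta>" "\<delta> \<le> 1" and s: "s = 3 * \<delta> + lam * (1 - \<delta>)"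
    and z: "z \<in> simplex3" and summable: "summable (\<lambda>n. \<Sum>i | length i = n. wt i z powr (- s))" and e: "0 < e"
  shows "hausdorff_content (1 + \<delta>) e rauzy_gasket = 0"
proof -
  define A where "A = (\<lambda>n. \<Sum>i | length i = n. wt i z powr (- s))"
  note l = contraction_exponent_bounds[OF lam]
  have s0: "0 < s" using \<delta> l unfolding s by (intro add_pos_nonneg) auto
  have fin: "finite {i :: 3 list. length i = n}" for n
    using finite_lists_length_eq[of "UNIV :: 3 set" n] by simp
  have A0: "0 \<le> A n" for n by (auto simp: A_def intro: sum_nonneg)
  \<comment> \<open>Solves \<open>4 * (R / 4) powr (- lam) = e\<close>. Since \<open>A\<close> tends
    to 0, long words have weight at least \<open>R\<close>, and their cylinders meet the scale
    \<open>e\<close>.\<close>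
  define R where "R = 4 * (4 / e) powr (1 / lam)"
  have R: "0 < R" using e by (simp add: R_def)
  have "A \<longlonglongrightarrow> 0" using summable unfolding A_def by (rule summable_LIMSEQ_zero)
  then obtain N0 where N0: "\<And>n. N0 \<le> n \<Longrightarrow> A n < R powr (- s)"
    using R order_tendstoD(2)[of A 0 sequentially "R powr (- s)"] by (auto simp: eventually_sequentially)
  have small: "4 * (wt i z / 4) powr (- lam) \<le> e" if "N0 \<le> length i" for i
  proof -
    have "wt i z powr (- s) \<le> A (length i)" unfolding A_def
      by (intro member_le_sum fin) auto
    then have lt: "wt i z powr (- s) < R powr (- s)" using N0[OF that] by simp
    have "R \<le> wt i z"
    proof (rule ccontr)
      assume "\<not> R \<le> wt i z"
      then have "R powr (- s) \<le> wt i z powr (- s)" using s0 wt_pos[OF z, of i] by (intro powr_mono2') auto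
      then show False using lt by simp
    qed
    then have "(wt i z / 4) powr (- lam) \<le> (R / 4) powr (- lam)"
      using l R by (intro powr_mono2') auto
    also have "\<dots> = e / 4" using l e by (simp add: R_def powr_powr powr_minus)
    finally show ?thesis by simp
  qed
  \<comment> \<open>The 9 counts all pairs of letters \<open>(a, b)\<close>.\<close>
  define C where "C = 24 * 4 powr s * 9"
  have C: "0 < C" by (simp add: C_def)
  have bound: "hausdorff_content (1 + \<delta>) e rauzy_gasket \<le> ennreal (C * (\<Sum>n. A (n + N)))" if N: "N0 \<le> N" for N
  proof -
    define F where "F = (\<lambda>(i, j). foldr T i (axis j 1)) ` ({i. length i = N} \<times> (UNIV :: 3 set))"
    define S where "S = (\<lambda>n. \<Union>(i, a, b)\<in>{i. length i = n + N} \<times> {(a :: 3, b). a \<noteq> b}. cylinder (i @ [a, b]))"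
    \<comment> \<open>The finite exceptional set becomes member 0 of the countable cover and
      contributes nothing.\<close>
    define V where "V = (\<lambda>n. case n of 0 \<Rightarrow> F | Suc n \<Rightarrow> S n)"
    have "finite F" unfolding F_def using fin by (intro finite_imageI finite_cartesian_product) auto
    have S: "hausdorff_content (1 + \<delta>) e (S n) \<le> ennreal (C * A (n + N))" for n
    proof -
      let ?I = "{i :: 3 list. length i = n + N} \<times> {(a :: 3, b :: 3). a \<noteq> b}"
      have "hausdorff_content (1 + \<delta>) e (S n)
         \<le> (\<Sum>(i, a, b)\<in>?I. hausdorff_content (1 + \<delta>) e (cylinder (i @ [a, b])))"
        unfolding S_def using fin e
        hausdorff_content_finite_subadditive[of ?I e "1 + \<delta>" "\<lambda>(i, a, b). cylinder (i @ [a, b])"]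
        by (simp add: split_beta')
      also have "\<dots> \<le> (\<Sum>(i, a, b)\<in>?I. ennreal (24 * 4 powr s * wt i z powr (- s)))"
        using N small by (intro sum_mono) (auto intro!: hausdorff_content_cylinder[OF lam \<delta> _ z _ s])
      also have "\<dots> = (\<Sum>i | length i = n + N. \<Sum>ab\<in>{(a :: 3, b :: 3). a \<noteq> b}. ennreal (24 * 4 powr s * wt i z powr (- s)))"
        using fin by (subst sum.cartesian_product) (simp add: split_beta')
      also have "\<dots> \<le> (\<Sum>i | length i = n + N. \<Sum>ab\<in>(UNIV :: (3 \<times> 3) set). ennreal (24 * 4 powr s * wt i z powr (- s)))"
        by (intro sum_mono sum_mono2) auto
      also have "\<dots> = (\<Sum>i | length i = n + N. ennreal (C * wt i z powr (- s)))"
        by (simp add: C_def ennreal_mult[symmetric] ennreal_of_nat_eq_real_of_nat card_cartesian_product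
              ennreal_numeral[symmetric] mult_ac del: ennreal_numeral)
      also have "\<dots> = ennreal (C * A (n + N))"
        using C by (subst sum_ennreal) (auto simp: A_def sum_distrib_left)
      finally show ?thesis .
    qed
    have sum': "summable (\<lambda>n. C * A (n + N))"
      using summable unfolding A_def[symmetric] by (intro summable_mult) (simp add: summable_iff_shift)
    have "hausdorff_content (1 + \<delta>) e rauzy_gasket \<le> hausdorff_content (1 + \<delta>) e (F \<union> (\<Union>n. S n))"
      unfolding F_def S_def by (rule hausdorff_content_mono[OF rauzy_gasket_cover])
    also have "F \<union> (\<Union>n. S n) = (\<Union>n. V n)"
      by (subst (2) UNIV_nat_eq) (simp add: V_def)
    also have "hausdorff_content (1 + \<delta>) e \<dots> \<le> (\<Sum>n. hausdorff_content (1 + \<delta>) e (V n))"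
      by (rule hausdorff_content_countable_subadditive)
    also have "\<dots> = (\<Sum>n. hausdorff_content (1 + \<delta>) e (V (n + 1))) + (\<Sum>n<1. hausdorff_content (1 + \<delta>) e (V n))"
      by (rule suminf_offset) simp
    also have "\<dots> = (\<Sum>n. hausdorff_content (1 + \<delta>) e (S n))"
      using hausdorff_content_finite[OF \<open>finite F\<close>, of e "1 + \<delta>"] e by (simp add: V_def)
    also have "\<dots> \<le> (\<Sum>n. ennreal (C * A (n + N)))" by (intro suminf_le S) auto
    also have "\<dots> = ennreal (C * (\<Sum>n. A (n + N)))"
      using sum' A0 C summable by (subst suminf_ennreal2) (auto simp: suminf_mult summable_iff_shift A_def[symmetric])
    finally show ?thesis .
  qed
  have "hausdorff_content (1 + \<delta>) e rauzy_gasket \<le> 0"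
  proof (rule ennreal_le_epsilon)
    fix r :: real assume r: "0 < r"
    obtain N1 where N1: "\<And>n. N1 \<le> n \<Longrightarrow> norm (\<Sum>k. A (k + n)) < r / C"
      using suminf_exist_split[of "r / C" A] r C summable unfolding A_def[symmetric] by auto
    have "(\<Sum>k. A (k + max N0 N1)) \<le> r / C" using N1[of "max N0 N1"] by simp
    then have "C * (\<Sum>k. A (k + max N0 N1)) \<le> r" using C by (simp add: field_simps)
    then show "hausdorff_content (1 + \<delta>) e rauzy_gasket \<le> 0 + ennreal r"
      using bound[of "max N0 N1"] by (auto intro: order_trans ennreal_leI)
  qed
  then show ?thesis by simp
qed

theorem theorem2p8:
  fixes m :: nat and lam \<delta> :: real
  assumes "m \<ge> 2"
    and "lam = 3 / 2 - 1 / sqrt 3"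
    and "\<delta> > (1 - lam) / (3 - lam)"
    and "(\<Sum>k. ennreal (mat_pow (indices m) (matD m lam \<delta>) (Suc k)
                          (Word (star m)) (Word (star m)))) \<le> 1"
  shows "hausdorff_dim rauzy_gasket \<le> ennreal (1 + \<delta>)"
proof -
  note lam = contraction_exponent_bounds[OF assms(2)]
  then have "0 < (1 - lam) / (3 - lam)" by simp
  then have \<delta>: "0 < \<delta>" using assms(3) by linarith
  show ?thesis
  proof (cases "\<delta> \<le> 1")
    case False
    have "hausdorff_content (1 + \<delta>) e rauzy_gasket = 0" if "0 < e" for e
      using hausdorff_content_simplex3[of "1 + \<delta>" e] hausdorff_content_mono[OF rauzy_gasket_subset, of "1 + \<delta>" e]
        False that by simp
    then show ?thesis using \<delta> by (intro hausdorff_dim_le) auto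
  next
    case True
    define s where "s = 3 * \<delta> + lam * (1 - \<delta>)"
    obtain z where z: "z \<in> cylinder (star m)" using cylinder_nonempty by blast
    let ?A = "\<lambda>n. \<Sum>i | length i = n. wt i z powr (- s)"
    let ?D = "\<lambda>k. mat_pow (indices m) (matD m lam \<delta>) (Suc k) (Word (star m)) (Word (star m))"
    let ?c = "2 powr (real (m + 1) * s)"
    \<comment> \<open>\<open>?D k\<close> is the power \<open>k + 1\<close>, so
      \<open>?D (n + m)\<close> is the return of length \<open>n + m + 1\<close>. The shifted series
      is a tail of the given one, hence finite.\<close>
    have "(\<Sum>n. ennreal (?A n)) \<le> (\<Sum>n. ennreal ?c * ennreal (?D (n + m)))"
    proof (intro suminf_le)
      fix n
      show "ennreal (?A n) \<le> ennreal ?c * ennreal (?D (n + m))"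
        unfolding ennreal_mult'[symmetric, OF powr_ge_zero]
        using sum_wt_le_return[OF assms(1) \<delta> True lam(1) s_def z, of n]
        by (rule ennreal_leI)
    qed auto
    also have "\<dots> = ennreal ?c * (\<Sum>n. ennreal (?D (n + m)))" by (rule ennreal_suminf_cmult)
    also have "\<dots> \<le> ennreal ?c * (\<Sum>n. ennreal (?D n))"
      by (intro mult_left_mono) (subst suminf_offset[of "\<lambda>n. ennreal (?D n)" m], auto simp del: mat_pow.simps)
    also have "\<dots> \<le> ennreal ?c * 1" using assms(4) by (intro mult_left_mono) auto
    finally have "(\<Sum>n. ennreal (?A n)) \<noteq> top" by (auto simp: top_unique)
    then have "summable ?A" by (intro summable_suminf_not_top) (auto intro: sum_nonneg)
    moreover have "z \<in> simplex3" using z cylinder_subset_simplex3 by blast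
    ultimately show ?thesis
      using \<delta> True by (intro hausdorff_dim_le hausdorff_content_rauzy_gasket[OF assms(2) _ _ s_def]) auto
  qed
qed

end
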